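(* Let $\alpha\in(0,1]$, let $\boldsymbol{Y}\sim\mathrm{MPH}^*_\alpha(\boldsymbol{\pi},\boldsymbol{T},\boldsymbol{R})$ be $n$-dimensional and let $\boldsymbol{w}\in[0,\infty)^n$ be a non-zero vector. Split the set of transient states $\{1,\dots,p\}$ into $E_+=\{i:(\boldsymbol{R}\boldsymbol{w})_i>0\}$ and $E_0=\{i:(\boldsymbol{R}\boldsymbol{w})_i=0\}$, and decompose accordingly $$\boldsymbol{\pi}=(\boldsymbol{\pi}_+,\boldsymbol{\pi}_0),\qquad \boldsymbol{T}=\begin{pmatrix}\boldsymbol{T}_{++}&\boldsymbol{T}_{+0}\\ \boldsymbol{T}_{0+}&\boldsymbol{T}_{00}\end{pmatrix}.$$ Then $\langle\boldsymbol{Y},\boldsymbol{w}\rangle$ has a distribution with an absolutely continuous part which is $\mathrm{PH}_\alpha(\boldsymbol{\pi}_{\boldsymbol{w}},\boldsymbol{T}_{\boldsymbol{w}})$ distributed, where $$\boldsymbol{\pi}_{\boldsymbol{w}}=\boldsymbol{\pi}_++\boldsymbol{\pi}_0(-\boldsymbol{T}_{00})^{-1}\boldsymbol{T}_{0+},\qquad \boldsymbol{T}_{\boldsymbol{w}}=\boldsymbol{\Delta}\left((\boldsymbol{R}\boldsymbol{w})_+^\alpha\right)^{-1}\left(\boldsymbol{T}_{++}+\boldsymbol{T}_{+0}(-\boldsymbol{T}_{00})^{-1}\boldsymbol{T}_{0+}\right),$$ and an atom at zero of size $1-\boldsymbol{\pi}_{\boldsymbol{w}}\boldsymbol{e}$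.
   Context: Parameters: $\boldsymbol{\pi}=(\pi_1,\dots,\pi_p)$ is a row vector of probabilities summing to $1$; $\boldsymbol{T}$ is a $p\times p$ sub-intensity matrix of transient states (negative diagonal entries, non-negative off-diagonal entries, $\boldsymbol{t}:=-\boldsymbol{T}\boldsymbol{e}\ge\boldsymbol{0}$ entrywise, $\boldsymbol{T}$ invertible); $\boldsymbol{R}$ is a $p\times n$ matrix with non-negative entries; $\boldsymbol{e}$ is the column vector of ones of appropriate dimension. $\mathrm{MPH}^*_\alpha(\boldsymbol{\pi},\boldsymbol{T},\boldsymbol{R})$ is the distribution on $[0,\infty)^n$ characterized by the joint Laplace transform $\mathbb{E}(e^{-\langle\boldsymbol{Y},\boldsymbol{\theta}\rangle})=\boldsymbol{\pi}(\boldsymbol{\Delta}(\boldsymbol{R}\boldsymbol{\theta})^\alpha-\boldsymbol{T})^{-1}\boldsymbol{t}$, $\boldsymbol{\theta}\in[0,\infty)^n$, where $\boldsymbol{\Delta}(\boldsymbol{v})$ is the diagonal matrix with diagonal $\boldsymbol{v}$ and $\boldsymbol{\Delta}(\boldsymbol{R}\boldsymbol{\theta})^\alpha$ is the diagonal matrix with entries $((\boldsymbol{R}\boldsymbol{\theta})_i)^\alpha$ (with $0^\alpha=0$). $(\boldsymbol{R}\boldsymbol{w})_+^\alpha$ is the vector with entries $((\boldsymbol{R}\boldsymbol{w})_i)^\alpha$, $i\in E_+$. $\mathrm{PH}_\alpha(\boldsymbol{\pi},\boldsymbol{T})$ (univariate fractional phase-type, or matrix Mittag-Leffler, distribution) has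 density $x^{\alpha-1}\boldsymbol{\pi}E_{\alpha,\alpha}(\boldsymbol{T}x^\alpha)\boldsymbol{t}$, $x>0$, and Laplace transform $\boldsymbol{\pi}(u^\alpha\boldsymbol{I}-\boldsymbol{T})^{-1}\boldsymbol{t}$ with $\boldsymbol{t}=-\boldsymbol{T}\boldsymbol{e}$, where $E_{\alpha,\beta}(\boldsymbol{M})=\sum_{k=0}^\infty \boldsymbol{M}^k/\Gamma(\alpha k+\beta)$. When $\boldsymbol{\pi}\boldsymbol{e}<1$ the same formulas are used and define a (defective) measure on $(0,\infty)$ of total mass $\boldsymbol{\pi}\boldsymbol{e}$. Thus the conclusion says that the law of $\langle\boldsymbol{Y},\boldsymbol{w}\rangle$ is $(1-\boldsymbol{\pi}_{\boldsymbol{w}}\boldsymbol{e})\delta_0$ plus the measure on $(0,\infty)$ with density $x^{\alpha-1}\boldsymbol{\pi}_{\boldsymbol{w}}E_{\alpha,\alpha}(\boldsymbol{T}_{\boldsymbol{w}}x^\alpha)(-\boldsymbol{T}_{\boldsymbol{w}}\boldsymbol{e})$. If $E_0$ is empty, the terms involving index $0$ are omitted; if $E_+$ is empty, the law is $\delta_0$. *)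

theory Defs
  imports
    "HOL-Probability.Probability"
    "Jordan_Normal_Form.Gauss_Jordan_Elimination"
    "Jordan_Normal_Form.DL_Submatrix"
begin

unbundle no inner_syntax
unbundle no vec_syntax

text \<open>
  Vectors and matrices have a dimension that is a natural number (and may be zero), since the
  sizes of the blocks below depend on the data. Indices start at 0. Row and column vectors are
  both of type \<^typ>\<open>real vec\<close>; a row vector acts on a matrix through \<open>vec_mat_mult\<close>.
\<close>

definition ones :: "nat \<Rightarrow> real vec" where
  "ones n = vec n (\<lambda>_. 1)"

definition vec_mat_mult :: "real vec \<Rightarrow> real mat \<Rightarrow> real vec"  (infixl \<open>\<^sub>v*\<close> 70) where
  "v \<^sub>v* A = transpose_mat A *\<^sub>v v"

text \<open>The value is unspecified when \<open>A\<close> is not invertible; the inverse of the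
  \<open>0 \<times> 0\<close> matrix is the \<open>0 \<times> 0\<close> matrix.\<close>

definition mat_inv :: "real mat \<Rightarrow> real mat" where
  "mat_inv A = the (mat_inverse A)"

text \<open>The vector counterpart of \<^const>\<open>submatrix\<close>: the entries with index in \<open>I\<close>, in
  increasing order of the index.\<close>

definition subvector :: "'b vec \<Rightarrow> nat set \<Rightarrow> 'b vec" where
  "subvector v I = vec (card {i. i < dim_vec v \<and> i \<in> I}) (\<lambda>i. v $ pick I i)"

definition nonneg_vec :: "nat \<Rightarrow> real vec \<Rightarrow> bool" where
  "nonneg_vec n v \<longleftrightarrow> v \<in> carrier_vec n \<and> (\<forall>i<n. 0 \<le> v $ i)"

definition nonneg_mat :: "nat \<Rightarrow> nat \<Rightarrow> real mat \<Rightarrow> bool" where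
  "nonneg_mat m n A \<longleftrightarrow> A \<in> carrier_mat m n \<and> (\<forall>i<m. \<forall>j<n. 0 \<le> A $$ (i, j))"

definition sub_intensity :: "nat \<Rightarrow> real mat \<Rightarrow> bool" where
  "sub_intensity p T \<longleftrightarrow>
     T \<in> carrier_mat p p \<and>
     (\<forall>i<p. T $$ (i, i) < 0) \<and>
     (\<forall>i<p. \<forall>j<p. i \<noteq> j \<longrightarrow> 0 \<le> T $$ (i, j)) \<and>
     nonneg_vec p (- (T *\<^sub>v ones p)) \<and>
     invertible_mat T"

text \<open>The diagonal matrix with entries \<open>v\<^sub>i\<^sup>\<alpha>\<close>; here \<open>0 powr \<alpha> = 0\<close>.\<close>

definition diag_powr :: "real vec \<Rightarrow> real \<Rightarrow> real mat" where
  "diag_powr v \<alpha> = mat_diag (dim_vec v) (\<lambda>i. (v $ i) powr \<alpha>)"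

definition mph_laplace ::
  "real \<Rightarrow> real vec \<Rightarrow> real mat \<Rightarrow> real mat \<Rightarrow> real vec \<Rightarrow> real" where
  "mph_laplace \<alpha> \<pi> T R \<theta> =
     \<pi> \<bullet> (mat_inv (diag_powr (R *\<^sub>v \<theta>) \<alpha> - T) *\<^sub>v (- (T *\<^sub>v ones (dim_row T))))"

text \<open>\<open>Y\<close> is an \<open>n\<close>-dimensional random vector on the probability space \<open>M\<close> whose law is
  \<open>MPH\<^sup>*\<^sub>\<alpha>(\<pi>, T, R)\<close>. There is no Borel structure on the type of vectors, so measurability
  is stated componentwise, which for a fixed finite dimension is the same as Borel
  measurability.\<close>

definition mph_distributed ::
  "'a measure \<Rightarrow> ('a \<Rightarrow> real vec) \<Rightarrow> nat \<Rightarrow> real \<Rightarrow> real vec \<Rightarrow> real mat \<Rightarrow> real mat \<Rightarrow> bool" where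
  "mph_distributed M Y n \<alpha> \<pi> T R \<longleftrightarrow>
     (\<forall>\<omega>\<in>space M. Y \<omega> \<in> carrier_vec n) \<and>
     (\<forall>j<n. (\<lambda>\<omega>. Y \<omega> $ j) \<in> borel_measurable M) \<and>
     (AE \<omega> in M. nonneg_vec n (Y \<omega>)) \<and>
     (\<forall>\<theta>. nonneg_vec n \<theta> \<longrightarrow>
        integral\<^sup>L M (\<lambda>\<omega>. exp (- (Y \<omega> \<bullet> \<theta>))) = mph_laplace \<alpha> \<pi> T R \<theta>)"

text \<open>The entrywise sum of the series \<open>\<Sum>k. A\<^sup>k / \<Gamma>(\<alpha> k + \<beta>)\<close>, which converges
  absolutely for all \<open>\<alpha>, \<beta> > 0\<close>.\<close>

definition mittag_leffler_mat :: "real \<Rightarrow> real \<Rightarrow> real mat \<Rightarrow> real mat" where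
  "mittag_leffler_mat \<alpha> \<beta> A =
     mat (dim_row A) (dim_row A)
       (\<lambda>(i, j). \<Sum>k. (A ^\<^sub>m k) $$ (i, j) / Gamma (\<alpha> * real k + \<beta>))"

definition ph_density :: "real \<Rightarrow> real vec \<Rightarrow> real mat \<Rightarrow> real \<Rightarrow> real" where
  "ph_density \<alpha> \<pi> T x =
     x powr (\<alpha> - 1) *
     (\<pi> \<bullet> (mittag_leffler_mat \<alpha> \<alpha> ((x powr \<alpha>) \<cdot>\<^sub>m T) *\<^sub>v (- (T *\<^sub>v ones (dim_row T)))))"

text \<open>Since \<^const>\<open>ennreal\<close> sends negative numbers to 0, this is the measure with the above
  density only when the latter is non-negative on \<open>(0, \<infinity>)\<close>.\<close>

definition ph_measure :: "real \<Rightarrow> real vec \<Rightarrow> real mat \<Rightarrow> real measure" where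
  "ph_measure \<alpha> \<pi> T =
     density lborel (\<lambda>x. ennreal (indicator {0<..} x * ph_density \<alpha> \<pi> T x))"

text \<open>The initial vector of a fractional phase-type law may be defective, i.e. have total mass
  less than 1. The case \<open>p = 0\<close> is allowed and gives the null measure.\<close>

definition ph_parameters :: "nat \<Rightarrow> real vec \<Rightarrow> real mat \<Rightarrow> bool" where
  "ph_parameters p \<pi> T \<longleftrightarrow> nonneg_vec p \<pi> \<and> \<pi> \<bullet> ones p \<le> 1 \<and> sub_intensity p T"

end

theory Submission
  imports Defs "Jordan_Normal_Form.Determinant"
begin

text \<open>Write \<open>v = R w\<close>, \<open>I = {i. v\<^sub>i > 0}\<close> and \<open>J = {i. v\<^sub>i = 0}\<close>. At \<open>\<theta> = u w\<close> the
  diagonal matrix in the Laplace transform of \<open>Y\<close> has the entries \<open>u\<^sup>\<alpha> v\<^sub>i\<^sup>\<alpha>\<close>, so it vanishes on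
  \<open>J\<close>, and the equations with index in \<open>J\<close> do not involve \<open>u\<close>. Gaussian elimination of these
  equations turns the \<open>p\<close>-dimensional resolvent into
  \<open>E (exp (- u \<langle>Y, w\<rangle>)) = (1 - \<pi>\<^sub>w e) + \<pi>\<^sub>w (u\<^sup>\<alpha> - T\<^sub>w)\<inverse> (- T\<^sub>w e)\<close>;
  this is \<open>mph_laplace_reduction\<close>. The inverses in this elimination exist and have nonnegative entries because
  \<open>- T\<close> is a nonsingular M-matrix (\<open>sub_intensity_imp_M_matrix\<close>), and this class is closed under
  principal submatrices, Schur complements, positive scaling of rows and addition of nonnegative
  diagonal matrices. The same closure properties, and the sign of the row sums, show that
  \<open>T\<^sub>w\<close> is a sub-intensity matrix.

  For large \<open>u\<close> the resolvent is the geometric series of the terms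
  \<open>\<pi>\<^sub>w T\<^sub>w\<^sup>k (- T\<^sub>w e) u\<^bsup>-\<alpha>(k+1)\<^esup>\<close> (\<open>resolvent_eq_series\<close>), and \<open>u\<^bsup>-\<alpha>(k+1)\<^esup>\<close> is the
  Laplace transform of \<open>x\<^bsup>\<alpha>(k+1)-1\<^esup> / \<Gamma>(\<alpha>(k+1))\<close>. Summation gives the Laplace transform of the
  fractional phase-type density (\<open>has_bochner_integral_laplace_ml_series\<close>).

  The sign of this density is not visible from the Mittag-Leffler series. It is deduced from the
  existence of \<open>Y\<close>: a finite measure on \<open>[0, \<infinity>)\<close> whose Laplace transform agrees, far out, with that
  of an atom at zero plus a possibly signed density \<open>f\<close> that is continuous on \<open>(0, \<infinity>)\<close> must be this
  atom plus \<open>f\<close>, and then \<open>f\<close> is nonnegative because the measure is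
  (\<open>laplace_transform_determines_law\<close>). The substitution \<open>y = exp (- x)\<close> reduces this to the fact
  that moments on \<open>[0, 1]\<close> determine integrals of continuous functions, i.e. to Weierstrass
  approximation.\<close>

section \<open>Inverse matrices and nonsingular M-matrices\<close>

lemma index_mult_mat_vec_sum:
  fixes A :: "real mat"
  assumes "A \<in> carrier_mat m n" "x \<in> carrier_vec n" "i < m"
  shows "(A *\<^sub>v x) $ i = (\<Sum>j<n. A $$ (i, j) * x $ j)"
  using assms by (auto simp: scalar_prod_def row_def atLeast0LessThan)

lemma inverse_mat_vec_cancel:
  fixes A :: "real mat"
  assumes "A \<in> carrier_mat n n" "B \<in> carrier_mat n n" "A * B = 1\<^sub>m n" "x \<in> carrier_vec n"
  shows "A *\<^sub>v (B *\<^sub>v x) = x"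
  using assoc_mult_mat_vec[OF assms(1,2,4)] one_mult_mat_vec[OF assms(4)] unfolding assms(3)
  by simp

text \<open>\<^const>\<open>mat_inv\<close> is unspecified at singular matrices, so every use of it below rests on this
  criterion.\<close>

lemma mat_inv_inverts:
  assumes A: "A \<in> carrier_mat n n"
    and inj: "\<And>x. x \<in> carrier_vec n \<Longrightarrow> A *\<^sub>v x = 0\<^sub>v n \<Longrightarrow> x = 0\<^sub>v n"
  shows "mat_inv A \<in> carrier_mat n n" "A * mat_inv A = 1\<^sub>m n" "mat_inv A * A = 1\<^sub>m n"
proof -
  have "Determinant.det A \<noteq> 0"
    using det_0_iff_vec_prod_zero_field[OF A] inj by blast
  then have "A \<in> Units (ring_mat TYPE(real) n ())"
    by (rule det_non_zero_imp_unit[OF A])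
  then obtain B where "mat_inverse A = Some B"
    using mat_inverse(1)[OF A] by fastforce
  then show "mat_inv A \<in> carrier_mat n n" "A * mat_inv A = 1\<^sub>m n" "mat_inv A * A = 1\<^sub>m n"
    using mat_inverse(2)[OF A] by (auto simp: mat_inv_def)
qed

lemma mat_inv_unique:
  assumes "A \<in> carrier_mat n n" "B \<in> carrier_mat n n" "B * A = 1\<^sub>m n"
  shows "mat_inv A = B"
proof -
  have "x = 0\<^sub>v n" if "x \<in> carrier_vec n" "A *\<^sub>v x = 0\<^sub>v n" for x
    using inverse_mat_vec_cancel[OF assms(2,1,3) that(1)] that(2) assms(2)
    by (auto simp: scalar_prod_def intro!: eq_vecI)
  note inv = mat_inv_inverts[OF assms(1) this]
  have "B = B * (A * mat_inv A)"
    using assms(2) inv(2) by simp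
  also have "\<dots> = (B * A) * mat_inv A"
    by (rule assoc_mult_mat[OF assms(2,1) inv(1), symmetric])
  finally show ?thesis
    using assms(3) inv(1) by simp
qed

text \<open>Nonsingular M-matrices, in the characterization by semipositivity. Among the equivalent
  definitions this one is convenient because the witness \<open>h\<close> can be restricted to principal
  submatrices and to Schur complements.\<close>

definition M_matrix :: "nat \<Rightarrow> real mat \<Rightarrow> bool" where
  "M_matrix n A \<longleftrightarrow>
     A \<in> carrier_mat n n \<and>
     (\<forall>i<n. \<forall>j<n. i \<noteq> j \<longrightarrow> A $$ (i, j) \<le> 0) \<and>
     (\<exists>h \<in> carrier_vec n. (\<forall>i<n. 0 < h $ i) \<and> (\<forall>i<n. 0 < (A *\<^sub>v h) $ i))"

text \<open>Let \<open>r = x\<^sub>k / h\<^sub>k\<close> be the smallest of the quotients \<open>x\<^sub>j / h\<^sub>j\<close>. Then \<open>x - r h\<close> is nonnegative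
  and vanishes at \<open>k\<close>, so the sign pattern of \<open>A\<close> gives \<open>(A x)\<^sub>k \<le> r (A h)\<^sub>k\<close>, which forces
  \<open>0 \<le> r\<close>.\<close>

lemma M_matrix_monotone:
  assumes M: "M_matrix n A" and x: "x \<in> carrier_vec n"
    and nonneg: "\<And>i. i < n \<Longrightarrow> 0 \<le> (A *\<^sub>v x) $ i" and i: "i < n"
  shows "0 \<le> x $ i"
proof -
  from M obtain h where A: "A \<in> carrier_mat n n"
    and off: "\<And>i j. i < n \<Longrightarrow> j < n \<Longrightarrow> i \<noteq> j \<Longrightarrow> A $$ (i, j) \<le> 0"
    and h: "h \<in> carrier_vec n" "\<And>i. i < n \<Longrightarrow> 0 < h $ i" "\<And>i. i < n \<Longrightarrow> 0 < (A *\<^sub>v h) $ i"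
    unfolding M_matrix_def by blast
  define r where "r = Min ((\<lambda>j. x $ j / h $ j) ` {..<n})"
  have fin: "finite ((\<lambda>j. x $ j / h $ j) ` {..<n})" "(\<lambda>j. x $ j / h $ j) ` {..<n} \<noteq> {}"
    using i by auto
  from Min_in[OF fin] obtain k where k: "k < n" "r = x $ k / h $ k"
    unfolding r_def by auto
  have r: "r * h $ j \<le> x $ j" if "j < n" for j
    using Min_le[OF fin(1), of "x $ j / h $ j"] that h(2)[OF that] unfolding r_def
    by (auto simp: field_simps)
  have "(A *\<^sub>v x) $ k \<le> r * (A *\<^sub>v h) $ k"
    unfolding index_mult_mat_vec_sum[OF A x k(1)] index_mult_mat_vec_sum[OF A h(1) k(1)]
      sum_distrib_left
  proof (rule sum_mono)
    fix j assume "j \<in> {..<n}"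
    then have "A $$ (k, j) * x $ j \<le> A $$ (k, j) * (r * h $ j)"
      using mult_left_mono_neg[OF r[of j] off[of k j]] k h(2)[of k] by (cases "j = k") auto
    then show "A $$ (k, j) * x $ j \<le> r * (A $$ (k, j) * h $ j)"
      by (simp only: mult.left_commute)
  qed
  then have "0 \<le> r * (A *\<^sub>v h) $ k"
    using nonneg[OF k(1)] by simp
  then have "0 \<le> r"
    using h(3)[OF k(1)] by (simp add: zero_le_mult_iff)
  then show ?thesis
    using r[OF i] h(2)[OF i] by (meson less_imp_le mult_nonneg_nonneg order_trans)
qed

lemma M_matrix_inj:
  assumes M: "M_matrix n A" and x: "x \<in> carrier_vec n" and eq: "A *\<^sub>v x = 0\<^sub>v n"
  shows "x = 0\<^sub>v n"
proof -
  have A: "A \<in> carrier_mat n n"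
    using M by (simp add: M_matrix_def)
  have "A *\<^sub>v (- x) = - (A *\<^sub>v x)"
    using A x by (auto intro!: eq_vecI)
  then have neg: "A *\<^sub>v (- x) = 0\<^sub>v n"
    using eq by (intro eq_vecI) auto
  have "x $ i = 0" if i: "i < n" for i
  proof (rule antisym)
    show "0 \<le> x $ i"
      by (rule M_matrix_monotone[OF M x _ i]) (simp add: eq)
    have "0 \<le> (- x) $ i"
      by (rule M_matrix_monotone[OF M _ _ i]) (use x in \<open>simp_all add: neg\<close>)
    then show "x $ i \<le> 0"
      using i x by simp
  qed
  then show ?thesis
    using x by (intro eq_vecI) auto
qed

lemma M_matrix_inverts:
  assumes "A \<in> carrier_mat n n" "M_matrix n A"
  shows "mat_inv A \<in> carrier_mat n n" "A * mat_inv A = 1\<^sub>m n" "mat_inv A * A = 1\<^sub>m n"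
  using mat_inv_inverts[OF assms(1) M_matrix_inj[OF assms(2)]] by auto

lemma M_matrix_mult_cancel:
  assumes M: "M_matrix n A" and x: "x \<in> carrier_vec n" and y: "y \<in> carrier_vec n"
    and eq: "A *\<^sub>v x = A *\<^sub>v y"
  shows "x = y"
proof -
  have A: "A \<in> carrier_mat n n"
    using M by (simp add: M_matrix_def)
  note inv = M_matrix_inverts[OF A M]
  have "x = mat_inv A *\<^sub>v (A *\<^sub>v x)"
    using inverse_mat_vec_cancel[OF inv(1) A inv(3) x] by simp
  also have "\<dots> = y"
    unfolding eq by (rule inverse_mat_vec_cancel[OF inv(1) A inv(3) y])
  finally show ?thesis .
qed

lemma M_matrix_inverse_nonneg:
  assumes M: "M_matrix n A" and x: "nonneg_vec n x"
  shows "nonneg_vec n (mat_inv A *\<^sub>v x)"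
proof -
  have A: "A \<in> carrier_mat n n"
    using M by (simp add: M_matrix_def)
  note inv = M_matrix_inverts[OF A M]
  have x': "x \<in> carrier_vec n"
    using x by (simp add: nonneg_vec_def)
  have y: "mat_inv A *\<^sub>v x \<in> carrier_vec n"
    using inv(1) x' by simp
  show ?thesis
    unfolding nonneg_vec_def
    using y M_matrix_monotone[OF M y] x
    unfolding inverse_mat_vec_cancel[OF A inv(1,2) x'] nonneg_vec_def by blast
qed

lemma M_matrix_diag_pos:
  assumes M: "M_matrix n A" and i: "i < n"
  shows "0 < A $$ (i, i)"
proof (rule ccontr)
  from M obtain h where A: "A \<in> carrier_mat n n"
    and off: "\<And>i j. i < n \<Longrightarrow> j < n \<Longrightarrow> i \<noteq> j \<Longrightarrow> A $$ (i, j) \<le> 0"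
    and h: "h \<in> carrier_vec n" "\<And>i. i < n \<Longrightarrow> 0 < h $ i" "\<And>i. i < n \<Longrightarrow> 0 < (A *\<^sub>v h) $ i"
    unfolding M_matrix_def by blast
  assume "\<not> 0 < A $$ (i, i)"
  then have "A $$ (i, j) \<le> 0" if "j < n" for j
    using off[OF i that] by (cases "j = i") auto
  then have "(A *\<^sub>v h) $ i \<le> 0"
    unfolding index_mult_mat_vec_sum[OF A h(1) i] using h(2)
    by (intro sum_nonpos mult_nonpos_nonneg) (auto intro: less_imp_le)
  then show False
    using h(3)[OF i] by simp
qed

lemma index_diag_add_mult_vec:
  fixes A :: "real mat"
  assumes A: "A \<in> carrier_mat n n" and x: "x \<in> carrier_vec n" and i: "i < n"
  shows "((mat_diag n d + A) *\<^sub>v x) $ i = d i * x $ i + (A *\<^sub>v x) $ i"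
proof -
  have "((mat_diag n d + A) *\<^sub>v x) $ i
      = (\<Sum>j<n. (if j = i then d j * x $ j else 0) + A $$ (i, j) * x $ j)"
    using A x i
    by (subst index_mult_mat_vec_sum[of _ n n]) (auto simp: mat_diag_def algebra_simps intro!: sum.cong)
  then show ?thesis
    using i by (simp add: sum.distrib index_mult_mat_vec_sum[OF A x i])
qed

lemma index_diag_mult_mult_vec:
  fixes A :: "real mat"
  assumes A: "A \<in> carrier_mat n n" and x: "x \<in> carrier_vec n" and i: "i < n"
  shows "((mat_diag n d * A) *\<^sub>v x) $ i = d i * (A *\<^sub>v x) $ i"
proof -
  have "mat_diag n d * A \<in> carrier_mat n n"
    by (rule mult_carrier_mat[OF mat_diag_dim A])
  then have "((mat_diag n d * A) *\<^sub>v x) $ i = (\<Sum>j<n. d i * A $$ (i, j) * x $ j)"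
    using i by (subst index_mult_mat_vec_sum[OF _ x i]) (auto simp: mat_diag_mult_left[OF A])
  then show ?thesis
    using index_mult_mat_vec_sum[OF A x i] by (simp add: sum_distrib_left mult.assoc)
qed

text \<open>A nonnegative witness is enough: if \<open>h\<^sub>i = 0\<close>, then only the nonpositive off-diagonal entries
  contribute to \<open>(A h)\<^sub>i\<close>, which is therefore not positive.\<close>

lemma M_matrixI:
  assumes A: "A \<in> carrier_mat n n"
    and off: "\<And>i j. i < n \<Longrightarrow> j < n \<Longrightarrow> i \<noteq> j \<Longrightarrow> A $$ (i, j) \<le> 0"
    and h: "nonneg_vec n h" and pos: "\<And>i. i < n \<Longrightarrow> 0 < (A *\<^sub>v h) $ i"
  shows "M_matrix n A"
proof -
  have h': "h \<in> carrier_vec n" "\<And>i. i < n \<Longrightarrow> 0 \<le> h $ i"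
    using h by (auto simp: nonneg_vec_def)
  have "0 < h $ i" if i: "i < n" for i
  proof (rule ccontr)
    assume "\<not> 0 < h $ i"
    then have "h $ i = 0"
      using h'(2)[OF i] by simp
    then have "A $$ (i, j) * h $ j \<le> 0" if "j < n" for j
      using off[OF i that] h'(2)[OF that] by (cases "j = i") (auto intro: mult_nonpos_nonneg)
    then have "(A *\<^sub>v h) $ i \<le> 0"
      unfolding index_mult_mat_vec_sum[OF A h'(1) i] by (intro sum_nonpos) auto
    then show False
      using pos[OF i] by simp
  qed
  then show ?thesis
    unfolding M_matrix_def using A off h'(1) pos by blast
qed

lemma M_matrixE:
  assumes "M_matrix n A"
  obtains h where "A \<in> carrier_mat n n"
    "\<And>i j. i < n \<Longrightarrow> j < n \<Longrightarrow> i \<noteq> j \<Longrightarrow> A $$ (i, j) \<le> 0"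
    "nonneg_vec n h" "\<And>i. i < n \<Longrightarrow> 0 < (A *\<^sub>v h) $ i"
  using assms unfolding M_matrix_def nonneg_vec_def by (meson less_imp_le)

lemma M_matrix_add_diag:
  assumes M: "M_matrix n A" and d: "\<And>i. i < n \<Longrightarrow> 0 \<le> d i"
  shows "M_matrix n (mat_diag n d + A)"
proof -
  from M obtain h where A: "A \<in> carrier_mat n n"
    and off: "\<And>i j. i < n \<Longrightarrow> j < n \<Longrightarrow> i \<noteq> j \<Longrightarrow> A $$ (i, j) \<le> 0"
    and h: "nonneg_vec n h" "\<And>i. i < n \<Longrightarrow> 0 < (A *\<^sub>v h) $ i"
    by (rule M_matrixE) blast
  show ?thesis
  proof (rule M_matrixI[OF _ _ h(1)])
    show "0 < ((mat_diag n d + A) *\<^sub>v h) $ i" if "i < n" for i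
      using that d[OF that] h(2)[OF that] h(1)
      by (subst index_diag_add_mult_vec[OF A]) (auto simp: nonneg_vec_def intro!: add_nonneg_pos)
  qed (use A off in \<open>auto simp: mat_diag_def\<close>)
qed

lemma M_matrix_scale_rows:
  assumes M: "M_matrix n A" and d: "\<And>i. i < n \<Longrightarrow> 0 < d i"
  shows "M_matrix n (mat_diag n d * A)"
proof -
  from M obtain h where A: "A \<in> carrier_mat n n"
    and off: "\<And>i j. i < n \<Longrightarrow> j < n \<Longrightarrow> i \<noteq> j \<Longrightarrow> A $$ (i, j) \<le> 0"
    and h: "nonneg_vec n h" "\<And>i. i < n \<Longrightarrow> 0 < (A *\<^sub>v h) $ i"
    by (rule M_matrixE) blast
  show ?thesis
  proof (rule M_matrixI[OF _ _ h(1)])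
    show "0 < ((mat_diag n d * A) *\<^sub>v h) $ i" if "i < n" for i
      using that d[OF that] h(2)[OF that] h(1)
      by (subst index_diag_mult_mult_vec[OF A]) (auto simp: nonneg_vec_def)
  qed (use A off d in \<open>auto simp: mat_diag_mult_left[OF A] intro!: mult_nonneg_nonpos intro: less_imp_le\<close>)
qed

lemma nonneg_mat_mult:
  assumes "nonneg_mat l m A" "nonneg_mat m n B"
  shows "nonneg_mat l n (A * B)"
  using assms unfolding nonneg_mat_def
  by (auto simp: scalar_prod_def intro!: sum_nonneg)

lemma nonneg_mat_mult_vec:
  assumes "nonneg_mat m n A" "nonneg_vec n x"
  shows "nonneg_vec m (A *\<^sub>v x)"
  using assms unfolding nonneg_mat_def nonneg_vec_def
  by (auto simp: scalar_prod_def intro!: sum_nonneg)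

lemma nonneg_scalar_prod:
  assumes "nonneg_vec n x" "nonneg_vec n y"
  shows "0 \<le> x \<bullet> y"
  using assms by (auto simp: nonneg_vec_def scalar_prod_def intro!: sum_nonneg)

lemma nonneg_mat_M_matrix_inv:
  assumes M: "M_matrix n A"
  shows "nonneg_mat n n (mat_inv A)"
proof -
  have A: "A \<in> carrier_mat n n"
    using M by (simp add: M_matrix_def)
  note inv = M_matrix_inverts[OF A M]
  have "0 \<le> mat_inv A $$ (i, j)" if "i < n" "j < n" for i j
  proof -
    have "nonneg_vec n (mat_inv A *\<^sub>v unit_vec n j)"
      using that by (intro M_matrix_inverse_nonneg[OF M]) (auto simp: nonneg_vec_def unit_vec_def)
    moreover have "(mat_inv A *\<^sub>v unit_vec n j) $ i = mat_inv A $$ (i, j)"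
      using that inv(1) by simp
    ultimately show ?thesis
      using that by (auto simp: nonneg_vec_def)
  qed
  then show ?thesis
    using inv(1) by (simp add: nonneg_mat_def)
qed

text \<open>The vector \<open>e\<close> of ones is only mapped to a nonnegative vector by \<open>- T\<close>, but \<open>\<epsilon> - T\<close> maps it to a
  positive one. Hence \<open>x = (\<epsilon> - T)\<inverse> e\<close> is nonnegative, and \<open>- T x = e - \<epsilon> x\<close>. Since \<open>T\<close> is
  invertible, \<open>x\<close> stays bounded as \<open>\<epsilon>\<close> tends to zero, so \<open>e - \<epsilon> x\<close> is positive for small \<open>\<epsilon>\<close> and
  \<open>x\<close> is the required witness.\<close>

lemma sub_intensity_imp_M_matrix:
  assumes "sub_intensity p T"
  shows "M_matrix p (- T)"
proof -
  from assms have T: "T \<in> carrier_mat p p"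
    and off: "\<And>i j. i < p \<Longrightarrow> j < p \<Longrightarrow> i \<noteq> j \<Longrightarrow> 0 \<le> T $$ (i, j)"
    and t: "nonneg_vec p (- (T *\<^sub>v ones p))" and "invertible_mat T"
    by (auto simp: sub_intensity_def)
  then obtain B where B: "T * B = 1\<^sub>m p" "B * T = 1\<^sub>m (dim_row B)"
    by (auto simp: invertible_mat_def inverts_mat_def)
  have B': "B \<in> carrier_mat p p"
    using T B[THEN arg_cong, of dim_col] by (auto intro!: carrier_matI)
  define A where "A = - T"
  have A: "A \<in> carrier_mat p p"
    using T by (simp add: A_def)
  have Ae: "(A *\<^sub>v ones p) $ i \<ge> 0" if "i < p" for i
    using t T that by (auto simp: A_def nonneg_vec_def ones_def)
  define G where "G = - B"
  have G: "G \<in> carrier_mat p p" "G * A = 1\<^sub>m p"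
    using B' B T by (auto simp: G_def A_def)
  define g where "g = (\<Sum>i<p. \<Sum>j<p. \<bar>G $$ (i, j)\<bar>)"
  have "0 \<le> g"
    unfolding g_def by (intro sum_nonneg) auto
  \<comment> \<open>From \<open>x = G (e - \<epsilon> x)\<close> the largest entry \<open>m\<close> of \<open>x\<close> satisfies \<open>m \<le> g (1 + \<epsilon> m)\<close>, and
    \<open>\<epsilon> g < 1/2\<close> turns this into \<open>\<epsilon> m < 1\<close>.\<close>
  define \<epsilon> where "\<epsilon> = 1 / (2 * (g + 1))"
  have \<epsilon>: "0 < \<epsilon>" "\<epsilon> * g < 1 / 2"
    using \<open>0 \<le> g\<close> by (auto simp: \<epsilon>_def field_simps)
  define A' where "A' = mat_diag p (\<lambda>_. \<epsilon>) + A"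
  have A': "A' \<in> carrier_mat p p"
    using A by (simp add: A'_def)
  have ones: "ones p \<in> carrier_vec p" "nonneg_vec p (ones p)"
    by (auto simp: ones_def nonneg_vec_def)
  have M': "M_matrix p A'"
  proof (rule M_matrixI[OF A' _ ones(2)])
    show "0 < (A' *\<^sub>v ones p) $ i" if "i < p" for i
      using \<epsilon>(1) Ae[OF that] that ones(1)
      unfolding A'_def by (subst index_diag_add_mult_vec[OF A]) (auto simp: ones_def intro!: add_pos_nonneg)
  qed (use A off T in \<open>auto simp: A'_def A_def mat_diag_def\<close>)
  note inv' = M_matrix_inverts[OF A' M']
  define x where "x = mat_inv A' *\<^sub>v ones p"
  have x: "x \<in> carrier_vec p" "\<And>i. i < p \<Longrightarrow> 0 \<le> x $ i" and x_nonneg: "nonneg_vec p x"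
    using M_matrix_inverse_nonneg[OF M' ones(2)] by (auto simp: x_def nonneg_vec_def)
  have Ax: "(A *\<^sub>v x) $ i = 1 - \<epsilon> * x $ i" if "i < p" for i
  proof -
    have "A' *\<^sub>v x = ones p"
      unfolding x_def by (rule inverse_mat_vec_cancel[OF A' inv'(1,2) ones(1)])
    then have "\<epsilon> * x $ i + (A *\<^sub>v x) $ i = ones p $ i"
      using index_diag_add_mult_vec[OF A x(1) that, of "\<lambda>_. \<epsilon>"] by (simp add: A'_def)
    then show ?thesis
      using that by (simp add: ones_def)
  qed
  define m where "m = Max (insert 0 ((\<lambda>i. x $ i) ` {..<p}))"
  have m: "x $ i \<le> m" if "i < p" for i
    unfolding m_def using that by (intro Max_ge) auto
  have "0 \<le> m"
    unfolding m_def by (intro Max_ge) auto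
  have bound: "x $ i \<le> g * (1 + \<epsilon> * m)" if i: "i < p" for i
  proof -
    have "x $ i = (G *\<^sub>v (A *\<^sub>v x)) $ i"
      using inverse_mat_vec_cancel[OF G(1) A G(2) x(1)] by simp
    also have "\<dots> = (\<Sum>j<p. G $$ (i, j) * (1 - \<epsilon> * x $ j))"
      using A x(1) Ax by (subst index_mult_mat_vec_sum[OF G(1) _ i]) auto
    also have "\<dots> \<le> (\<Sum>j<p. \<bar>G $$ (i, j)\<bar> * (1 + \<epsilon> * m))"
    proof (rule sum_mono)
      fix j assume "j \<in> {..<p}"
      then have "0 \<le> \<epsilon> * x $ j" "\<epsilon> * x $ j \<le> \<epsilon> * m"
        using m x(2) \<epsilon>(1) by auto
      then have "\<bar>1 - \<epsilon> * x $ j\<bar> \<le> 1 + \<epsilon> * m"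
        by linarith
      then show "G $$ (i, j) * (1 - \<epsilon> * x $ j) \<le> \<bar>G $$ (i, j)\<bar> * (1 + \<epsilon> * m)"
        using mult_left_mono[of _ _ "\<bar>G $$ (i, j)\<bar>"] abs_ge_self[of "G $$ (i, j) * (1 - \<epsilon> * x $ j)"]
        unfolding abs_mult by (meson abs_ge_zero order_trans)
    qed
    also have "\<dots> = (\<Sum>j<p. \<bar>G $$ (i, j)\<bar>) * (1 + \<epsilon> * m)"
      by (simp add: sum_distrib_right)
    also have "\<dots> \<le> g * (1 + \<epsilon> * m)"
      unfolding g_def using i \<open>0 \<le> m\<close> \<epsilon>(1)
      by (intro mult_right_mono member_le_sum[of i "{..<p}" "\<lambda>i. \<Sum>j<p. \<bar>G $$ (i, j)\<bar>"])
        (auto intro: sum_nonneg)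
    finally show ?thesis .
  qed
  have "m \<le> g * (1 + \<epsilon> * m)"
  proof -
    have "m \<in> insert 0 ((\<lambda>i. x $ i) ` {..<p})"
      unfolding m_def by (intro Max_in) auto
    moreover have "0 \<le> g * (1 + \<epsilon> * m)"
      using \<open>0 \<le> g\<close> \<open>0 \<le> m\<close> \<epsilon>(1) by (intro mult_nonneg_nonneg add_nonneg_nonneg) auto
    ultimately show ?thesis
      using bound by auto
  qed
  then have "\<epsilon> * m \<le> \<epsilon> * (g * (1 + \<epsilon> * m))"
    using \<epsilon>(1) by (intro mult_left_mono) auto
  also have "\<dots> = (\<epsilon> * g) * (1 + \<epsilon> * m)"
    by simp
  also have "\<dots> < 1 / 2 * (1 + \<epsilon> * m)"
    using \<epsilon> \<open>0 \<le> m\<close> by (intro mult_strict_right_mono) (auto intro!: add_pos_nonneg)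
  finally have "\<epsilon> * m < 1"
    by simp
  show ?thesis
    unfolding A_def[symmetric]
  proof (rule M_matrixI[OF A _ x_nonneg])
    show "0 < (A *\<^sub>v x) $ i" if "i < p" for i
    proof -
      have "\<epsilon> * x $ i \<le> \<epsilon> * m"
        using m[OF that] \<epsilon>(1) by simp
      then show ?thesis
        using Ax[OF that] \<open>\<epsilon> * m < 1\<close> by simp
    qed
  qed (use T off in \<open>auto simp: A_def\<close>)
qed

lemma M_matrix_imp_sub_intensity:
  assumes M: "M_matrix n (- T)" and t: "nonneg_vec n (- (T *\<^sub>v ones n))"
  shows "sub_intensity n T"
proof -
  have T': "- T \<in> carrier_mat n n"
    using M by (simp add: M_matrix_def)
  then have T: "T \<in> carrier_mat n n"
    by simp
  note inv = M_matrix_inverts[OF T' M]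
  have "T * (- mat_inv (- T)) = - T * mat_inv (- T)" "(- mat_inv (- T)) * T = mat_inv (- T) * (- T)"
    using inv(1) T by simp_all
  then have "T * (- mat_inv (- T)) = 1\<^sub>m n" "(- mat_inv (- T)) * T = 1\<^sub>m n"
    using inv(2,3) by simp_all
  then have "inverts_mat T (- mat_inv (- T))" "inverts_mat (- mat_inv (- T)) T"
    using T inv(1) by (simp_all only: inverts_mat_def index_uminus_mat carrier_matD)
  then have "invertible_mat T"
    using T unfolding invertible_mat_def by (auto simp only: square_mat.simps carrier_matD)
  moreover have "T $$ (i, i) < 0" if "i < n" for i
    using M_matrix_diag_pos[OF M that] T that by simp
  moreover have "0 \<le> T $$ (i, j)" if "i < n" "j < n" "i \<noteq> j" for i j
  proof -
    have "(- T) $$ (i, j) \<le> 0"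
      using M that unfolding M_matrix_def by blast
    then show ?thesis
      using T that by simp
  qed
  ultimately show ?thesis
    using T t by (simp add: sub_intensity_def)
qed

section \<open>Blocks of vectors and matrices\<close>

lemma Collect_less_mem: "I \<subseteq> {..<p} \<Longrightarrow> {i. i < p \<and> i \<in> I} = I"
  by auto

lemma bij_betw_pick:
  assumes "finite I"
  shows "bij_betw (pick I) {..<card I} I"
proof -
  have "strict_mono_on {..<card I} (pick I)"
    by (auto simp: strict_mono_on_def intro: pick_mono_le)
  then have inj: "inj_on (pick I) {..<card I}"
    by (rule strict_mono_on_imp_inj_on)
  have "pick I ` {..<card I} \<subseteq> I"
    using pick_in_set_le by auto
  then have "pick I ` {..<card I} = I"
    using card_image[OF inj] by (intro card_subset_eq[OF assms]) auto
  with inj show ?thesis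
    by (simp add: bij_betw_def)
qed

lemma sum_pick: "finite I \<Longrightarrow> (\<Sum>i<card I. f (pick I i)) = sum f I"
  by (rule sum.reindex_bij_betw[OF bij_betw_pick])

lemma subvector_carrier:
  "x \<in> carrier_vec p \<Longrightarrow> I \<subseteq> {..<p} \<Longrightarrow> subvector x I \<in> carrier_vec (card I)"
  by (auto simp: subvector_def Collect_less_mem)

lemma index_subvector:
  "x \<in> carrier_vec p \<Longrightarrow> I \<subseteq> {..<p} \<Longrightarrow> i < card I \<Longrightarrow> subvector x I $ i = x $ pick I i"
  by (auto simp: subvector_def Collect_less_mem)

lemma submatrix_carrier:
  "A \<in> carrier_mat m n \<Longrightarrow> I \<subseteq> {..<m} \<Longrightarrow> J \<subseteq> {..<n} \<Longrightarrow>
   submatrix A I J \<in> carrier_mat (card I) (card J)"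
  by (auto simp: submatrix_def Collect_less_mem)

lemma index_submatrix:
  "A \<in> carrier_mat m n \<Longrightarrow> I \<subseteq> {..<m} \<Longrightarrow> J \<subseteq> {..<n} \<Longrightarrow> i < card I \<Longrightarrow> j < card J \<Longrightarrow>
   submatrix A I J $$ (i, j) = A $$ (pick I i, pick J j)"
  by (auto simp: submatrix_def Collect_less_mem)

lemma pick_less:
  assumes "I \<subseteq> {..<p}" "i < card I"
  shows "pick I i < p"
  using pick_in_set_le[OF assms(2)] assms(1) by auto

lemma pick_neq:
  assumes "i < card I" "j < card I" "i \<noteq> j"
  shows "pick I i \<noteq> pick I j"
  using pick_mono_le[OF assms(1), of j] pick_mono_le[OF assms(2), of i] assms(3)
  by (cases i j rule: linorder_cases) auto

lemma nonneg_subvector: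
  "nonneg_vec p x \<Longrightarrow> I \<subseteq> {..<p} \<Longrightarrow> nonneg_vec (card I) (subvector x I)"
  by (auto simp: nonneg_vec_def index_subvector subvector_carrier pick_less)

lemma subvector_ones: "I \<subseteq> {..<p} \<Longrightarrow> subvector (ones p) I = ones (card I)"
  by (auto simp: ones_def subvector_def Collect_less_mem pick_less intro!: eq_vecI)

lemma uminus_subvector:
  "x \<in> carrier_vec p \<Longrightarrow> I \<subseteq> {..<p} \<Longrightarrow> subvector (- x) I = - subvector x (I :: nat set)"
  for x :: "real vec"
  by (auto simp: subvector_def Collect_less_mem pick_less intro!: eq_vecI)

lemma uminus_submatrix:
  "A \<in> carrier_mat m n \<Longrightarrow> I \<subseteq> {..<m} \<Longrightarrow> J \<subseteq> {..<n} \<Longrightarrow>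
   submatrix (- A) I J = - submatrix A I J"
  for A :: "real mat"
  by (auto simp: submatrix_def Collect_less_mem pick_less intro!: eq_matI)

lemma scalar_prod_split:
  fixes x y :: "real vec"
  assumes xy: "x \<in> carrier_vec p" "y \<in> carrier_vec p"
    and IJ: "I \<union> J = {..<p}" "I \<inter> J = {}"
  shows "x \<bullet> y = subvector x I \<bullet> subvector y I + subvector x J \<bullet> subvector y J"
proof -
  have sub: "I \<subseteq> {..<p}" "J \<subseteq> {..<p}" and fin: "finite I" "finite J"
    using IJ(1) finite_subset[of _ "{..<p}"] by auto
  have sp: "subvector x K \<bullet> subvector y K = (\<Sum>k\<in>K. x $ k * y $ k)" if "K \<subseteq> {..<p}" for K
  proof -
    have "subvector x K \<bullet> subvector y K = (\<Sum>i<card K. x $ pick K i * y $ pick K i)"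
      using subvector_carrier[OF xy(2) that] index_subvector[OF xy(1) that] index_subvector[OF xy(2) that]
      by (simp add: scalar_prod_def atLeast0LessThan)
    then show ?thesis
      using finite_subset[OF that] by (simp add: sum_pick[of K "\<lambda>k. x $ k * y $ k"])
  qed
  have "x \<bullet> y = (\<Sum>k\<in>I \<union> J. x $ k * y $ k)"
    using xy IJ(1) by (simp add: scalar_prod_def atLeast0LessThan)
  then show ?thesis
    unfolding sp[OF sub(1)] sp[OF sub(2)] by (simp add: sum.union_disjoint[OF fin IJ(2)])
qed

lemma subvector_mult_mat_vec:
  fixes A :: "real mat"
  assumes A: "A \<in> carrier_mat m p" and x: "x \<in> carrier_vec p"
    and IJ: "I \<union> J = {..<p}" "I \<inter> J = {}" and K: "K \<subseteq> {..<m}"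
  shows "subvector (A *\<^sub>v x) K
      = submatrix A K I *\<^sub>v subvector x I + submatrix A K J *\<^sub>v subvector x J"
proof (rule eq_vecI)
  have sub: "I \<subseteq> {..<p}" "J \<subseteq> {..<p}"
    using IJ(1) by auto
  have Ax: "A *\<^sub>v x \<in> carrier_vec m"
    using A x by simp
  show "dim_vec (subvector (A *\<^sub>v x) K)
      = dim_vec (submatrix A K I *\<^sub>v subvector x I + submatrix A K J *\<^sub>v subvector x J)"
    using subvector_carrier[OF Ax K] submatrix_carrier[OF A K sub(2)] by simp
  fix i assume "i < dim_vec (submatrix A K I *\<^sub>v subvector x I + submatrix A K J *\<^sub>v subvector x J)"
  then have i: "i < card K"
    using submatrix_carrier[OF A K sub(2)] by simp
  have row: "subvector (row A (pick K i)) L = row (submatrix A K L) i" if "L \<subseteq> {..<p}" for L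
  proof -
    have r: "row A (pick K i) \<in> carrier_vec p"
      using A by auto
    show ?thesis
      using A i that pick_less[OF K i] submatrix_carrier[OF A K that] subvector_carrier[OF r that]
      by (intro eq_vecI) (auto simp: index_submatrix[OF A K that i] index_subvector[OF r that] pick_less)
  qed
  have "subvector (A *\<^sub>v x) K $ i = row A (pick K i) \<bullet> x"
    using A pick_less[OF K i] by (simp add: index_subvector[OF Ax K i])
  also have "\<dots> = row (submatrix A K I) i \<bullet> subvector x I + row (submatrix A K J) i \<bullet> subvector x J"
    using A pick_less[OF K i] scalar_prod_split[OF _ x IJ, of "row A (pick K i)"]
    by (simp add: row sub)
  finally show "subvector (A *\<^sub>v x) K $ i
      = (submatrix A K I *\<^sub>v subvector x I + submatrix A K J *\<^sub>v subvector x J) $ i"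
    using i submatrix_carrier[OF A K sub(1)] submatrix_carrier[OF A K sub(2)] by simp
qed

lemma M_matrix_off_diag_block:
  assumes M: "M_matrix p A" and sub: "I \<subseteq> {..<p}" "J \<subseteq> {..<p}" and disj: "I \<inter> J = {}"
  shows "nonneg_mat (card I) (card J) (- submatrix A I J)"
proof -
  have A: "A \<in> carrier_mat p p"
    and off: "\<And>i j. i < p \<Longrightarrow> j < p \<Longrightarrow> i \<noteq> j \<Longrightarrow> A $$ (i, j) \<le> 0"
    using M unfolding M_matrix_def by blast+
  have "A $$ (pick I i, pick J j) \<le> 0" if "i < card I" "j < card J" for i j
  proof (rule off)
    show "pick I i \<noteq> pick J j"
      using pick_in_set_le[OF that(1)] pick_in_set_le[OF that(2)] disj by auto
  qed (use that sub in \<open>auto intro: pick_less\<close>)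
  then show ?thesis
    using submatrix_carrier[OF A sub] by (auto simp: nonneg_mat_def index_submatrix[OF A sub])
qed

text \<open>The witness restricts, since the columns that are left out contribute nonpositive amounts to
  \<open>A h\<close>.\<close>

lemma M_matrix_submatrix:
  assumes M: "M_matrix p A" and IJ: "I \<union> J = {..<p}" "I \<inter> J = {}"
  shows "M_matrix (card I) (submatrix A I I)"
proof -
  from M obtain h where A: "A \<in> carrier_mat p p"
    and off: "\<And>i j. i < p \<Longrightarrow> j < p \<Longrightarrow> i \<noteq> j \<Longrightarrow> A $$ (i, j) \<le> 0"
    and h: "nonneg_vec p h" "\<And>i. i < p \<Longrightarrow> 0 < (A *\<^sub>v h) $ i"
    by (rule M_matrixE) blast
  have h': "h \<in> carrier_vec p"
    using h(1) by (simp add: nonneg_vec_def)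
  have sub: "I \<subseteq> {..<p}" "J \<subseteq> {..<p}"
    using IJ by auto
  note carr = submatrix_carrier[OF A sub(1,1)] submatrix_carrier[OF A sub(1,2)]
    subvector_carrier[OF h' sub(1)] subvector_carrier[OF h' sub(2)]
  show ?thesis
  proof (rule M_matrixI[OF carr(1) _ nonneg_subvector[OF h(1) sub(1)]])
    show "submatrix A I I $$ (i, j) \<le> 0" if "i < card I" "j < card I" "i \<noteq> j" for i j
      using that off pick_neq[OF that] sub(1) by (simp add: index_submatrix[OF A] pick_less)
    show "0 < (submatrix A I I *\<^sub>v subvector h I) $ i" if i: "i < card I" for i
    proof -
      from nonneg_mat_mult_vec[OF M_matrix_off_diag_block[OF M sub IJ(2)] nonneg_subvector[OF h(1) sub(2)]] i
      have "(submatrix A I J *\<^sub>v subvector h J) $ i \<le> 0"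
        using carr by (auto simp: nonneg_vec_def)
      moreover have "(A *\<^sub>v h) $ pick I i
          = (submatrix A I I *\<^sub>v subvector h I) $ i + (submatrix A I J *\<^sub>v subvector h J) $ i"
        using arg_cong[OF subvector_mult_mat_vec[OF A h' IJ sub(1)], of "\<lambda>v. v $ i"] i carr A h'
        by (simp add: index_subvector[of _ p] sub(1) del: index_mult_mat_vec)
      ultimately show ?thesis
        using h(2)[OF pick_less[OF sub(1) i]] by simp
    qed
  qed
qed

text \<open>Block Gaussian elimination: \<open>K\<close> inverts \<open>- D\<close>, so the second block row can be solved for \<open>y\<close>;
  substituting the solution into the first one leaves the Schur complement.\<close>

lemma block_elimination:
  fixes A B C D K :: "real mat"
  assumes carr: "A \<in> carrier_mat a a" "B \<in> carrier_mat a b" "C \<in> carrier_mat b a" "D \<in> carrier_mat b b"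
      "K \<in> carrier_mat b b" "x \<in> carrier_vec a" "y \<in> carrier_vec b"
    and K: "K * (- D) = 1\<^sub>m b"
  shows "y = K *\<^sub>v (C *\<^sub>v x) - K *\<^sub>v (C *\<^sub>v x + D *\<^sub>v y)"
    and "(A + B * K * C) *\<^sub>v x = (A *\<^sub>v x + B *\<^sub>v y) + B *\<^sub>v (K *\<^sub>v (C *\<^sub>v x + D *\<^sub>v y))"
proof -
  have "K *\<^sub>v (- D *\<^sub>v y) = y"
    using carr K by (intro inverse_mat_vec_cancel) auto
  moreover have "- D *\<^sub>v y = - (D *\<^sub>v y)"
    using carr by simp
  moreover have "K *\<^sub>v (- (D *\<^sub>v y)) = - (K *\<^sub>v (D *\<^sub>v y))"
    using carr by (intro eq_vecI) auto
  ultimately have "K *\<^sub>v (D *\<^sub>v y) = - y"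
    by (metis uminus_uminus_vec)
  then have sol: "K *\<^sub>v (C *\<^sub>v x + D *\<^sub>v y) = K *\<^sub>v (C *\<^sub>v x) + (- y)"
    using carr by (simp add: mult_add_distrib_mat_vec[of _ b b])
  then show "y = K *\<^sub>v (C *\<^sub>v x) - K *\<^sub>v (C *\<^sub>v x + D *\<^sub>v y)"
    using carr by (auto intro!: eq_vecI)
  have "B *\<^sub>v (K *\<^sub>v (C *\<^sub>v x + D *\<^sub>v y)) = B *\<^sub>v (K *\<^sub>v (C *\<^sub>v x)) + - (B *\<^sub>v y)"
    unfolding sol using carr
    by (subst mult_add_distrib_mat_vec[of _ a b]) (auto intro!: eq_vecI)
  moreover have "(A + B * K * C) *\<^sub>v x = A *\<^sub>v x + B *\<^sub>v (K *\<^sub>v (C *\<^sub>v x))"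
  proof -
    have "(B * K * C) *\<^sub>v x = B *\<^sub>v (K *\<^sub>v (C *\<^sub>v x))"
      using carr assoc_mult_mat_vec[of "B * K" a b C a x] assoc_mult_mat_vec[of B a b K b "C *\<^sub>v x"]
      by simp
    then show ?thesis
      using carr add_mult_distrib_mat_vec[of A a a "B * K * C" x] by simp
  qed
  moreover have "A *\<^sub>v x + Y = (A *\<^sub>v x + B *\<^sub>v y) + (Y + - (B *\<^sub>v y))" if "Y \<in> carrier_vec a" for Y
    using carr that by (intro eq_vecI) (auto simp del: index_mult_mat_vec)
  moreover have "B *\<^sub>v (K *\<^sub>v (C *\<^sub>v x)) \<in> carrier_vec a"
    using carr by simp
  ultimately show "(A + B * K * C) *\<^sub>v x
      = (A *\<^sub>v x + B *\<^sub>v y) + B *\<^sub>v (K *\<^sub>v (C *\<^sub>v x + D *\<^sub>v y))"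
    by (simp only:)
qed

section \<open>Eliminating the states without reward\<close>

lemma vec_mat_mult_carrier:
  "A \<in> carrier_mat m n \<Longrightarrow> v \<^sub>v* A \<in> carrier_vec n"
  by (intro carrier_vecI) (simp add: vec_mat_mult_def)

lemma vec_mat_mult_scalar_prod:
  assumes "A \<in> carrier_mat m n" "v \<in> carrier_vec m" "x \<in> carrier_vec n"
  shows "(v \<^sub>v* A) \<bullet> x = v \<bullet> (A *\<^sub>v x)"
  unfolding vec_mat_mult_def by (rule transpose_vec_mult_scalar[OF assms(1,3,2)])

lemma nonneg_vec_mat_mult:
  assumes "nonneg_mat m n A" "nonneg_vec m v"
  shows "nonneg_vec n (v \<^sub>v* A)"
  unfolding vec_mat_mult_def
  by (rule nonneg_mat_mult_vec[OF _ assms(2)]) (use assms(1) in \<open>auto simp: nonneg_mat_def\<close>)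

lemma nonneg_vec_add: "nonneg_vec n x \<Longrightarrow> nonneg_vec n y \<Longrightarrow> nonneg_vec n (x + y)"
  by (auto simp: nonneg_vec_def)

lemma nonneg_vec_uminusI:
  "y \<in> carrier_vec n \<Longrightarrow> (\<And>i. i < n \<Longrightarrow> y $ i \<le> 0) \<Longrightarrow> nonneg_vec n (- y)"
  for y :: "real vec"
  by (auto simp: nonneg_vec_def)

lemma ones_carrier: "ones n \<in> carrier_vec n"
  by (simp add: ones_def)

text \<open>Reward accrues in the states in \<open>I\<close> and not in those in \<open>J\<close>. If the Markov jump process with
  sub-intensity matrix \<open>T\<close> is observed only while it is in \<open>I\<close>, one sees a process with
  sub-intensity matrix \<open>schur\<close> and initial vector \<open>entry_vec \<pi>\<close>. The entries of \<open>green\<close> are the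
  expected times spent in the states of \<open>J\<close> before \<open>J\<close> is left.\<close>

locale partitioned_sub_intensity =
  fixes p :: nat and T :: "real mat" and I J :: "nat set"
  assumes T: "sub_intensity p T"
    and IJ: "I \<union> J = {..<p}" "I \<inter> J = {}"
begin

definition green :: "real mat" where
  "green = mat_inv (- submatrix T J J)"

definition schur :: "real mat" where
  "schur = submatrix T I I + submatrix T I J * green * submatrix T J I"

definition entry_vec :: "real vec \<Rightarrow> real vec" where
  "entry_vec \<pi> = subvector \<pi> I + subvector \<pi> J \<^sub>v* green \<^sub>v* submatrix T J I"

lemma M_matrix_minus_T: "M_matrix p (- T)"
  by (rule sub_intensity_imp_M_matrix[OF T])

lemma T_carrier: "T \<in> carrier_mat p p"
  using T by (simp add: sub_intensity_def)

lemma subsets: "I \<subseteq> {..<p}" "J \<subseteq> {..<p}" and JI: "J \<union> I = {..<p}" "J \<inter> I = {}"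
  using IJ by auto

lemmas block_carrier = submatrix_carrier[OF T_carrier subsets(1) subsets(1)] submatrix_carrier[OF T_carrier subsets(1) subsets(2)]
  submatrix_carrier[OF T_carrier subsets(2) subsets(1)] submatrix_carrier[OF T_carrier subsets(2) subsets(2)]

lemma M_matrix_JJ: "M_matrix (card J) (- submatrix T J J)"
  using M_matrix_submatrix[OF M_matrix_minus_T JI] by (simp add: uminus_submatrix[OF T_carrier subsets(2) subsets(2)])

lemma minus_JJ_carrier: "- submatrix T J J \<in> carrier_mat (card J) (card J)"
  using block_carrier(4) by simp

lemma green_carrier: "green \<in> carrier_mat (card J) (card J)"
  and green_inverse: "green * (- submatrix T J J) = 1\<^sub>m (card J)"
  unfolding green_def using M_matrix_inverts[OF minus_JJ_carrier M_matrix_JJ] by auto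

lemma green_nonneg: "nonneg_mat (card J) (card J) green"
  unfolding green_def by (rule nonneg_mat_M_matrix_inv[OF M_matrix_JJ])

lemma off_diag_nonneg:
  "nonneg_mat (card I) (card J) (submatrix T I J)" "nonneg_mat (card J) (card I) (submatrix T J I)"
  using M_matrix_off_diag_block[OF M_matrix_minus_T subsets IJ(2)] M_matrix_off_diag_block[OF M_matrix_minus_T subsets(2,1) JI(2)]
  by (simp_all add: uminus_submatrix[OF T_carrier] subsets)

lemma schur_carrier: "schur \<in> carrier_mat (card I) (card I)"
  unfolding schur_def using block_carrier green_carrier by simp

lemma entry_vec_carrier: "\<pi> \<in> carrier_vec p \<Longrightarrow> entry_vec \<pi> \<in> carrier_vec (card I)"
  unfolding entry_vec_def
  by (intro add_carrier_vec subvector_carrier[OF _ subsets(1)] vec_mat_mult_carrier[OF block_carrier(3)])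

lemma subvector_J_eq:
  assumes x: "x \<in> carrier_vec p"
  shows "subvector x J = green *\<^sub>v (submatrix T J I *\<^sub>v subvector x I) - green *\<^sub>v subvector (T *\<^sub>v x) J"
  unfolding subvector_mult_mat_vec[OF T_carrier x IJ subsets(2)]
  by (rule block_elimination(1)[OF block_carrier green_carrier
        subvector_carrier[OF x subsets(1)] subvector_carrier[OF x subsets(2)] green_inverse])

lemma schur_mult_subvector:
  assumes x: "x \<in> carrier_vec p"
  shows "schur *\<^sub>v subvector x I
      = subvector (T *\<^sub>v x) I + submatrix T I J *\<^sub>v (green *\<^sub>v subvector (T *\<^sub>v x) J)"
  unfolding subvector_mult_mat_vec[OF T_carrier x IJ subsets(1)]
    subvector_mult_mat_vec[OF T_carrier x IJ subsets(2)] schur_def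
  by (rule block_elimination(2)[OF block_carrier green_carrier
        subvector_carrier[OF x subsets(1)] subvector_carrier[OF x subsets(2)] green_inverse])

text \<open>In this form both terms on the right have nonnegative entries as soon as \<open>- (T x)\<close> has. The cases of interest are \<open>x = e\<close> and the witness
  that \<open>- T\<close> is an M-matrix.\<close>

lemma minus_schur_mult_subvector:
  assumes x: "x \<in> carrier_vec p"
  shows "- (schur *\<^sub>v subvector x I)
      = subvector (- (T *\<^sub>v x)) I + submatrix T I J *\<^sub>v (green *\<^sub>v subvector (- (T *\<^sub>v x)) J)"
proof -
  define y where "y = T *\<^sub>v x"
  have y: "y \<in> carrier_vec p"
    using T_carrier x by (simp add: y_def)
  have neg: "A *\<^sub>v (- z) = - (A *\<^sub>v z)" if "A \<in> carrier_mat m n" "z \<in> carrier_vec n"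
    for A :: "real mat" and z m n
    using that by (intro eq_vecI) auto
  have Ky: "green *\<^sub>v subvector y J \<in> carrier_vec (card J)"
    using green_carrier subvector_carrier[OF y subsets(2)] by simp
  show ?thesis
    unfolding schur_mult_subvector[OF x] y_def[symmetric]
    unfolding uminus_subvector[OF y subsets(1)] uminus_subvector[OF y subsets(2)]
      neg[OF green_carrier subvector_carrier[OF y subsets(2)]] neg[OF block_carrier(2) Ky]
    using subvector_carrier[OF y subsets(1)] block_carrier(2) by (intro eq_vecI) auto
qed

lemma nonneg_minus_schur_mult_subvector:
  assumes x: "x \<in> carrier_vec p" and y: "nonneg_vec p (- (T *\<^sub>v x))"
  shows "nonneg_vec (card I) (- (schur *\<^sub>v subvector x I))"
  unfolding minus_schur_mult_subvector[OF x]
  by (intro nonneg_vec_add nonneg_subvector[OF y] subsets nonneg_mat_mult_vec[OF off_diag_nonneg(1)]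
      nonneg_mat_mult_vec[OF green_nonneg])

text \<open>By \<open>minus_schur_mult_subvector\<close> the restriction to \<open>I\<close> of the witness for \<open>- T\<close> is mapped to a
  vector that dominates the restriction of a positive one.\<close>

lemma M_matrix_minus_schur: "M_matrix (card I) (- schur)"
proof -
  from M_matrix_minus_T obtain h where
    off: "\<And>i j. i < p \<Longrightarrow> j < p \<Longrightarrow> i \<noteq> j \<Longrightarrow> (- T) $$ (i, j) \<le> 0"
    and h: "nonneg_vec p h" "\<And>i. i < p \<Longrightarrow> 0 < (- T *\<^sub>v h) $ i"
    by (rule M_matrixE) blast
  have h': "h \<in> carrier_vec p"
    using h(1) by (simp add: nonneg_vec_def)
  define y where "y = - (T *\<^sub>v h)"
  have y: "y \<in> carrier_vec p" "\<And>i. i < p \<Longrightarrow> 0 < y $ i"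
    using h(2) h' T_carrier by (auto simp: y_def)
  have y': "nonneg_vec p y"
    using y by (auto simp: nonneg_vec_def intro: less_imp_le)
  have prod: "nonneg_mat (card I) (card I) (submatrix T I J * green * submatrix T J I)"
    by (intro nonneg_mat_mult[OF nonneg_mat_mult[OF off_diag_nonneg(1) green_nonneg]] off_diag_nonneg)
  show ?thesis
  proof (rule M_matrixI[OF _ _ nonneg_subvector[OF h(1) subsets(1)]])
    show "(- schur) $$ (i, j) \<le> 0" if "i < card I" "j < card I" "i \<noteq> j" for i j
    proof -
      have "0 \<le> T $$ (pick I i, pick I j)"
        using off[of "pick I i" "pick I j"] that pick_neq[OF that] pick_less[OF subsets(1)] T_carrier by simp
      moreover have "0 \<le> (submatrix T I J * green * submatrix T J I) $$ (i, j)"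
        using prod that unfolding nonneg_mat_def by blast
      moreover have "(submatrix T I I + submatrix T I J * green * submatrix T J I) $$ (i, j)
          = T $$ (pick I i, pick I j) + (submatrix T I J * green * submatrix T J I) $$ (i, j)"
        using that block_carrier prod unfolding nonneg_mat_def
        by (subst index_add_mat) (auto simp: index_submatrix[OF T_carrier subsets(1) subsets(1)])
      moreover have "(- schur) $$ (i, j) = - (schur $$ (i, j))"
        using that schur_carrier by simp
      ultimately show ?thesis
        unfolding schur_def by linarith
    qed
    show "0 < (- schur *\<^sub>v subvector h I) $ i" if i: "i < card I" for i
    proof -
      have "nonneg_vec (card I) (submatrix T I J *\<^sub>v (green *\<^sub>v subvector y J))"
        by (intro nonneg_mat_mult_vec[OF off_diag_nonneg(1)] nonneg_mat_mult_vec[OF green_nonneg]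
            nonneg_subvector[OF y'] subsets)
      then have z: "submatrix T I J *\<^sub>v (green *\<^sub>v subvector y J) \<in> carrier_vec (card I)"
        "0 \<le> (submatrix T I J *\<^sub>v (green *\<^sub>v subvector y J)) $ i"
        using i unfolding nonneg_vec_def by blast+
      have "- schur *\<^sub>v subvector h I = subvector y I + submatrix T I J *\<^sub>v (green *\<^sub>v subvector y J)"
        using minus_schur_mult_subvector[OF h'] schur_carrier subvector_carrier[OF h' subsets(1)]
        by (simp add: y_def)
      then have "(- schur *\<^sub>v subvector h I) $ i
          = y $ pick I i + (submatrix T I J *\<^sub>v (green *\<^sub>v subvector y J)) $ i"
        using i z(1) by (simp only: index_add_vec carrier_vecD index_subvector[OF y(1) subsets(1) i])
      then show ?thesis
        using y(2)[OF pick_less[OF subsets(1) i]] z(2) by simp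
    qed
  qed (use schur_carrier in simp)
qed

lemma entry_vec_scalar_prod:
  assumes \<pi>: "\<pi> \<in> carrier_vec p" and y: "y \<in> carrier_vec (card I)"
  shows "entry_vec \<pi> \<bullet> y = subvector \<pi> I \<bullet> y + subvector \<pi> J \<bullet> (green *\<^sub>v (submatrix T J I *\<^sub>v y))"
proof -
  have "submatrix T J I *\<^sub>v y \<in> carrier_vec (card J)"
    using block_carrier(3) y by simp
  then show ?thesis
    unfolding entry_vec_def
    using vec_mat_mult_scalar_prod[OF block_carrier(3) vec_mat_mult_carrier[OF green_carrier] y]
      vec_mat_mult_scalar_prod[OF green_carrier subvector_carrier[OF \<pi> subsets(2)]]
      add_scalar_prod_distrib[OF subvector_carrier[OF \<pi> subsets(1)] vec_mat_mult_carrier[OF block_carrier(3)] y]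
    by simp
qed

lemma scalar_prod_eq_entry_vec:
  assumes \<pi>: "\<pi> \<in> carrier_vec p" and x: "x \<in> carrier_vec p"
  shows "\<pi> \<bullet> x = entry_vec \<pi> \<bullet> subvector x I - subvector \<pi> J \<bullet> (green *\<^sub>v subvector (T *\<^sub>v x) J)"
proof -
  have Tx: "T *\<^sub>v x \<in> carrier_vec p"
    using T_carrier x by simp
  have carr: "green *\<^sub>v (submatrix T J I *\<^sub>v subvector x I) \<in> carrier_vec (card J)"
    "green *\<^sub>v subvector (T *\<^sub>v x) J \<in> carrier_vec (card J)"
    using green_carrier block_carrier(3) subvector_carrier[OF x subsets(1)] subvector_carrier[OF Tx subsets(2)] by simp_all
  have "\<pi> \<bullet> x = subvector \<pi> I \<bullet> subvector x I + subvector \<pi> J \<bullet> subvector x J"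
    by (rule scalar_prod_split[OF \<pi> x IJ])
  also have "subvector \<pi> J \<bullet> subvector x J
      = subvector \<pi> J \<bullet> (green *\<^sub>v (submatrix T J I *\<^sub>v subvector x I))
        - subvector \<pi> J \<bullet> (green *\<^sub>v subvector (T *\<^sub>v x) J)"
    unfolding subvector_J_eq[OF x]
    by (rule scalar_prod_minus_distrib[OF subvector_carrier[OF \<pi> subsets(2)] carr])
  finally show ?thesis
    by (simp add: entry_vec_scalar_prod[OF \<pi> subvector_carrier[OF x subsets(1)]])
qed

lemma T_ones_carrier: "T *\<^sub>v ones p \<in> carrier_vec p"
  and exit_nonneg: "nonneg_vec p (- (T *\<^sub>v ones p))"
  using T by (auto simp: sub_intensity_def ones_def)

text \<open>The mass \<open>\<pi> e - entry_vec \<pi> e = \<pi>\<^sub>J green t\<^sub>J\<close>, where \<open>t = - T e\<close>, is the probability of absorption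
  without a visit to \<open>I\<close>; this is the size of the atom at zero.\<close>

lemma entry_vec_mass:
  assumes \<pi>: "nonneg_vec p \<pi>"
  shows "nonneg_vec (card I) (entry_vec \<pi>)" "entry_vec \<pi> \<bullet> ones (card I) \<le> \<pi> \<bullet> ones p"
proof -
  have \<pi>': "\<pi> \<in> carrier_vec p"
    using \<pi> by (simp add: nonneg_vec_def)
  show "nonneg_vec (card I) (entry_vec \<pi>)"
    unfolding entry_vec_def
    by (intro nonneg_vec_add nonneg_subvector[OF \<pi>] nonneg_vec_mat_mult[OF off_diag_nonneg(2)]
        nonneg_vec_mat_mult[OF green_nonneg] subsets)
  have "0 \<le> subvector \<pi> J \<bullet> (green *\<^sub>v subvector (- (T *\<^sub>v ones p)) J)"
    by (intro nonneg_scalar_prod[OF nonneg_subvector[OF \<pi> subsets(2)]] nonneg_mat_mult_vec[OF green_nonneg]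
        nonneg_subvector[OF exit_nonneg] subsets)
  also have "\<dots> = - (subvector \<pi> J \<bullet> (green *\<^sub>v subvector (T *\<^sub>v ones p) J))"
  proof -
    have "green *\<^sub>v (- z) = - (green *\<^sub>v z)" if "z \<in> carrier_vec (card J)" for z
      using green_carrier that by (intro eq_vecI) auto
    then show ?thesis
      using subvector_carrier[OF T_ones_carrier subsets(2)] subvector_carrier[OF \<pi>' subsets(2)] green_carrier
      by (simp add: uminus_subvector[OF T_ones_carrier subsets(2)])
  qed
  finally show "entry_vec \<pi> \<bullet> ones (card I) \<le> \<pi> \<bullet> ones p"
    using scalar_prod_eq_entry_vec[OF \<pi>' ones_carrier] by (simp add: subvector_ones[OF subsets(1)])
qed

lemma sub_intensity_scaled_schur:
  assumes d: "\<And>i. i < card I \<Longrightarrow> 0 < d i"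
  shows "sub_intensity (card I) (mat_diag (card I) d * schur)"
proof (rule M_matrix_imp_sub_intensity)
  have "- (mat_diag (card I) d * schur) = mat_diag (card I) d * (- schur)"
    by (rule uminus_mult_right_mat[symmetric])
      (simp add: carrier_matD[OF mat_diag_dim] carrier_matD[OF schur_carrier])
  then show "M_matrix (card I) (- (mat_diag (card I) d * schur))"
    using M_matrix_scale_rows[OF M_matrix_minus_schur d] by simp
  have "nonneg_vec (card I) (- (schur *\<^sub>v ones (card I)))"
    using nonneg_minus_schur_mult_subvector[OF ones_carrier exit_nonneg]
    by (simp add: subvector_ones[OF subsets(1)])
  then have "(schur *\<^sub>v ones (card I)) $ i \<le> 0" if "i < card I" for i
    using that schur_carrier unfolding nonneg_vec_def by (simp del: index_mult_mat_vec)
  then have "((mat_diag (card I) d * schur) *\<^sub>v ones (card I)) $ i \<le> 0" if "i < card I" for i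
    unfolding index_diag_mult_mult_vec[OF schur_carrier ones_carrier that]
    using that d[OF that] by (intro mult_nonneg_nonpos) (auto intro: less_imp_le)
  moreover have "mat_diag (card I) d * schur \<in> carrier_mat (card I) (card I)"
    by (rule mult_carrier_mat[OF mat_diag_dim schur_carrier])
  ultimately show "nonneg_vec (card I) (- ((mat_diag (card I) d * schur) *\<^sub>v ones (card I)))"
    by (intro nonneg_vec_uminusI carrier_vecI) (auto simp del: index_mult_mat_vec)
qed

text \<open>Since \<open>\<delta>\<close> vanishes on \<open>J\<close>, the vectors \<open>T x\<close> and \<open>T e\<close> have the same entries there. Hence the terms
  that the elimination of \<open>J\<close> produces are the same for \<open>x\<close> and for \<open>e\<close>, and they cancel when the
  two identities are subtracted.\<close>

lemma resolvent_reduction: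
  assumes \<pi>: "\<pi> \<in> carrier_vec p" and x: "x \<in> carrier_vec p"
    and eq: "(mat_diag p \<delta> + - T) *\<^sub>v x = - (T *\<^sub>v ones p)"
    and J: "\<And>i. i \<in> J \<Longrightarrow> \<delta> i = 0"
  shows "i < card I \<Longrightarrow>
      (schur *\<^sub>v subvector x I) $ i = \<delta> (pick I i) * subvector x I $ i + (schur *\<^sub>v ones (card I)) $ i"
    and "\<pi> \<bullet> x = \<pi> \<bullet> ones p - entry_vec \<pi> \<bullet> ones (card I) + entry_vec \<pi> \<bullet> subvector x I"
proof -
  have Tx: "T *\<^sub>v x \<in> carrier_vec p" and mT: "- T \<in> carrier_mat p p"
    using T_carrier x by simp_all
  have Tx_eq: "(T *\<^sub>v x) $ i = \<delta> i * x $ i + (T *\<^sub>v ones p) $ i" if "i < p" for i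
  proof -
    have "(- T *\<^sub>v x) $ i = - (T *\<^sub>v x) $ i"
      using T_carrier x that by simp
    moreover have "(- (T *\<^sub>v ones p)) $ i = - (T *\<^sub>v ones p) $ i"
      using T_carrier that by simp
    ultimately show ?thesis
      using index_diag_add_mult_vec[OF mT x that, of \<delta>] unfolding eq by linarith
  qed
  have J_eq: "subvector (T *\<^sub>v x) J = subvector (T *\<^sub>v ones p) J"
  proof (rule eq_vecI)
    show "dim_vec (subvector (T *\<^sub>v x) J) = dim_vec (subvector (T *\<^sub>v ones p) J)"
      using subvector_carrier[OF Tx subsets(2)] subvector_carrier[OF T_ones_carrier subsets(2)] by simp
    fix i assume "i < dim_vec (subvector (T *\<^sub>v ones p) J)"
    then have i: "i < card J"
      using subvector_carrier[OF T_ones_carrier subsets(2)] by simp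
    show "subvector (T *\<^sub>v x) J $ i = subvector (T *\<^sub>v ones p) J $ i"
      unfolding index_subvector[OF Tx subsets(2) i] index_subvector[OF T_ones_carrier subsets(2) i]
      using Tx_eq[OF pick_less[OF subsets(2) i]] J[OF pick_in_set_le[OF i]] by simp
  qed
  show "(schur *\<^sub>v subvector x I) $ i = \<delta> (pick I i) * subvector x I $ i + (schur *\<^sub>v ones (card I)) $ i"
    if i: "i < card I"
  proof -
    define z where "z = submatrix T I J *\<^sub>v (green *\<^sub>v subvector (T *\<^sub>v ones p) J)"
    have z: "z \<in> carrier_vec (card I)"
      unfolding z_def using carrier_matD[OF block_carrier(2)] by (intro carrier_vecI) simp
    have "schur *\<^sub>v subvector x I = subvector (T *\<^sub>v x) I + z"
      unfolding z_def schur_mult_subvector[OF x] J_eq ..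
    moreover have "schur *\<^sub>v ones (card I) = subvector (T *\<^sub>v ones p) I + z"
      using schur_mult_subvector[OF ones_carrier] by (simp add: subvector_ones[OF subsets(1)] z_def)
    ultimately show ?thesis
      using i z Tx_eq[OF pick_less[OF subsets(1) i]]
      by (simp only: index_add_vec carrier_vecD index_subvector[OF Tx subsets(1) i]
          index_subvector[OF T_ones_carrier subsets(1) i] index_subvector[OF x subsets(1) i])
  qed
  show "\<pi> \<bullet> x = \<pi> \<bullet> ones p - entry_vec \<pi> \<bullet> ones (card I) + entry_vec \<pi> \<bullet> subvector x I"
    using scalar_prod_eq_entry_vec[OF \<pi> x] scalar_prod_eq_entry_vec[OF \<pi> ones_carrier]
    by (simp add: J_eq subvector_ones[OF subsets(1)])
qed

end

section \<open>The joint Laplace transform along a ray\<close>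

lemma mat_inv_diag_powr:
  assumes x: "x \<in> carrier_vec n" and pos: "\<And>i. i < n \<Longrightarrow> 0 < x $ i"
  shows "mat_inv (diag_powr x \<alpha>) = mat_diag n (\<lambda>i. (x $ i) powr (- \<alpha>))"
proof (rule mat_inv_unique)
  show "diag_powr x \<alpha> \<in> carrier_mat n n"
    using x by (simp add: diag_powr_def)
  have "mat_diag n (\<lambda>i. (x $ i) powr (- \<alpha>) * (x $ i) powr \<alpha>) = 1\<^sub>m n"
    using pos by (intro eq_matI) (auto simp: mat_diag_def powr_minus less_imp_neq[THEN not_sym])
  then show "mat_diag n (\<lambda>i. (x $ i) powr (- \<alpha>)) * diag_powr x \<alpha> = 1\<^sub>m n"
    using x by (simp add: diag_powr_def)
qed simp

text \<open>The equation for \<open>y\<close> says that \<open>y = (u\<^sup>\<alpha> - W)\<inverse> (- W e)\<close>; as a linear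
  system it can be compared directly with the geometric series for the resolvent.\<close>

lemma (in partitioned_sub_intensity) mph_laplace_reduction:
  fixes \<alpha> :: real and \<pi> v \<theta> :: "real vec" and R :: "real mat" and u :: real
  assumes \<pi>: "\<pi> \<in> carrier_vec p" and v: "v \<in> carrier_vec p"
    and v_I: "\<And>i. i \<in> I \<Longrightarrow> 0 < v $ i" and v_J: "\<And>i. i \<in> J \<Longrightarrow> v $ i = 0"
    and u: "0 \<le> u" and \<theta>: "R *\<^sub>v \<theta> = u \<cdot>\<^sub>v v"
  defines "W \<equiv> mat_inv (diag_powr (subvector v I) \<alpha>) * schur"
  shows "sub_intensity (card I) W"
    and "\<exists>y \<in> carrier_vec (card I).
      (\<forall>i < card I. (W *\<^sub>v y) $ i = u powr \<alpha> * y $ i + (W *\<^sub>v ones (card I)) $ i) \<and>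
      mph_laplace \<alpha> \<pi> T R \<theta> = \<pi> \<bullet> ones p - entry_vec \<pi> \<bullet> ones (card I) + entry_vec \<pi> \<bullet> y"
proof -
  have v_carrier: "subvector v I \<in> carrier_vec (card I)"
    by (rule subvector_carrier[OF v subsets(1)])
  have v_pos: "0 < subvector v I $ i" if "i < card I" for i
    using index_subvector[OF v subsets(1) that] v_I[OF pick_in_set_le[OF that]] by simp
  define d where "d = (\<lambda>i. (subvector v I $ i) powr (- \<alpha>))"
  have W: "W = mat_diag (card I) d * schur"
  proof -
    have "mat_inv (diag_powr (subvector v I) \<alpha>) = mat_diag (card I) d"
      unfolding d_def by (rule mat_inv_diag_powr[OF v_carrier v_pos])
    then show ?thesis
      by (simp add: W_def)
  qed
  have d_pos: "0 < d i" if "i < card I" for i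
    using v_pos[OF that] by (simp add: d_def)
  show "sub_intensity (card I) W"
    unfolding W by (rule sub_intensity_scaled_schur[OF d_pos])
  define \<delta> where "\<delta> = (\<lambda>i. (u * v $ i) powr \<alpha>)"
  define A where "A = mat_diag p \<delta> + - T"
  have MA: "M_matrix p A"
    unfolding A_def by (rule M_matrix_add_diag[OF M_matrix_minus_T]) (simp add: \<delta>_def)
  then have A: "A \<in> carrier_mat p p"
    by (simp add: M_matrix_def)
  have t: "- (T *\<^sub>v ones p) \<in> carrier_vec p"
    using T_ones_carrier by simp
  define x where "x = mat_inv A *\<^sub>v (- (T *\<^sub>v ones p))"
  have x: "x \<in> carrier_vec p"
    unfolding x_def using M_matrix_inverts(1)[OF A MA] t by simp
  have Ax: "A *\<^sub>v x = - (T *\<^sub>v ones p)"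
    unfolding x_def by (rule inverse_mat_vec_cancel[OF A M_matrix_inverts(1,2)[OF A MA] t])
  have diag: "diag_powr (u \<cdot>\<^sub>v v) \<alpha> = mat_diag p \<delta>"
    using v by (intro eq_matI) (auto simp: diag_powr_def mat_diag_def \<delta>_def)
  have A_eq: "diag_powr (R *\<^sub>v \<theta>) \<alpha> - T = A"
    unfolding \<theta> diag A_def by (rule minus_add_uminus_mat[OF mat_diag_dim T_carrier])
  have laplace: "mph_laplace \<alpha> \<pi> T R \<theta> = \<pi> \<bullet> x"
    unfolding mph_laplace_def A_eq x_def using T_carrier by simp
  have \<delta>_J: "\<delta> i = 0" if "i \<in> J" for i
    using v_J[OF that] by (simp add: \<delta>_def)
  have eq: "(mat_diag p \<delta> + - T) *\<^sub>v x = - (T *\<^sub>v ones p)"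
    using Ax by (simp only: A_def)
  have y: "subvector x I \<in> carrier_vec (card I)"
    by (rule subvector_carrier[OF x subsets(1)])
  have "(W *\<^sub>v subvector x I) $ i = u powr \<alpha> * subvector x I $ i + (W *\<^sub>v ones (card I)) $ i"
    if i: "i < card I" for i
  proof -
    have "d i * \<delta> (pick I i) = u powr \<alpha>"
      using u v_pos[OF i] index_subvector[OF v subsets(1) i]
      by (simp add: d_def \<delta>_def powr_mult powr_minus field_simps)
    moreover have "d i * (schur *\<^sub>v subvector x I) $ i
        = d i * \<delta> (pick I i) * subvector x I $ i + d i * (schur *\<^sub>v ones (card I)) $ i"
    proof -
      have "(schur *\<^sub>v subvector x I) $ i
          = \<delta> (pick I i) * subvector x I $ i + (schur *\<^sub>v ones (card I)) $ i"
        by (rule resolvent_reduction(1)[OF \<pi> x eq \<delta>_J i])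
      then show ?thesis
        by (simp only: distrib_left mult.assoc)
    qed
    ultimately show ?thesis
      unfolding W index_diag_mult_mult_vec[OF schur_carrier y i]
        index_diag_mult_mult_vec[OF schur_carrier ones_carrier i] by simp
  qed
  then show "\<exists>y \<in> carrier_vec (card I).
      (\<forall>i < card I. (W *\<^sub>v y) $ i = u powr \<alpha> * y $ i + (W *\<^sub>v ones (card I)) $ i) \<and>
      mph_laplace \<alpha> \<pi> T R \<theta> = \<pi> \<bullet> ones p - entry_vec \<pi> \<bullet> ones (card I) + entry_vec \<pi> \<bullet> y"
    using y resolvent_reduction(2)[OF \<pi> x eq \<delta>_J] laplace
    by (intro bexI[of _ "subvector x I"]) (simp_all del: index_mult_mat_vec)
qed

section \<open>Mittag-Leffler type densities and their Laplace transforms\<close>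

text \<open>This keeps only the part of the Gamma integral over \<open>[b, b + 1]\<close>. As \<open>b\<close> is arbitrary, it shows
  that the Gamma function outgrows every exponential function.\<close>

lemma Gamma_lower_bound:
  fixes b s :: real
  assumes b: "0 < b" and s: "1 \<le> s"
  shows "b powr (s - 1) * exp (- (b + 1)) \<le> Gamma s"
proof -
  have "ennreal (b powr (s - 1) * exp (- (b + 1)))
      = (\<integral>\<^sup>+t. ennreal (b powr (s - 1) * exp (- (b + 1))) * indicator {b..b + 1} t \<partial>lborel)"
    by (subst nn_integral_cmult_indicator) auto
  also have "\<dots> \<le> (\<integral>\<^sup>+t. ennreal (indicator {0..} t * t powr (s - 1) / exp t) \<partial>lborel)"
  proof (rule nn_integral_mono)
    fix t :: real
    have "b powr (s - 1) * exp (- (b + 1)) \<le> t powr (s - 1) * exp (- t)" if "b \<le> t" "t \<le> b + 1"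
      using that b s by (intro mult_mono powr_mono2) auto
    then show "ennreal (b powr (s - 1) * exp (- (b + 1))) * indicator {b..b + 1} t
        \<le> ennreal (indicator {0..} t * t powr (s - 1) / exp t)"
      using b by (auto simp: indicator_def exp_minus field_simps intro!: ennreal_leI)
  qed
  also have "\<dots> = ennreal (Gamma s)"
    using s Gamma_conv_nn_integral_real[of s] by simp
  finally show ?thesis
    using s Gamma_real_pos[of s] by (simp add: ennreal_le_iff less_imp_le)
qed

lemma summable_mittag_leffler:
  fixes \<alpha> \<beta> z :: real
  assumes \<alpha>: "0 < \<alpha>" and \<beta>: "0 < \<beta>" and z: "0 \<le> z"
  shows "summable (\<lambda>k. z ^ k / Gamma (\<alpha> * real k + \<beta>))"
proof -
  \<comment> \<open>This choice makes the lower bounds for the Gamma values grow like \<open>(2 z + 1)\<^sup>k\<close>, so that the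
    series is dominated by a geometric one with ratio below \<open>1/2\<close>.\<close>
  define b where "b = (2 * z + 1) powr (1 / \<alpha>)"
  have b: "0 < b" "b powr \<alpha> = 2 * z + 1"
    using \<alpha> z by (auto simp: b_def powr_powr)
  define C where "C = 1 / (b powr (\<beta> - 1) * exp (- (b + 1)))"
  obtain N where N: "1 \<le> \<alpha> * real N"
    using reals_Archimedean3[OF \<alpha>] by (metis less_imp_le mult.commute)
  show ?thesis
  proof (rule summable_comparison_test_ev)
    show "summable (\<lambda>k. C * (z / (2 * z + 1)) ^ k)"
      using z by (intro summable_mult summable_geometric) (auto simp: field_simps)
    have "norm (z ^ k / Gamma (\<alpha> * real k + \<beta>)) \<le> C * (z / (2 * z + 1)) ^ k" if "N \<le> k" for k
    proof -
      have "1 \<le> \<alpha> * real k"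
        by (rule order_trans[OF N mult_left_mono]) (use that \<alpha> in auto)
      then have s: "1 \<le> \<alpha> * real k + \<beta>"
        using \<beta> by simp
      have "b powr (\<alpha> * real k + \<beta> - 1) = (2 * z + 1) ^ k * b powr (\<beta> - 1)"
      proof -
        have "b powr (\<alpha> * real k + \<beta> - 1) = (b powr \<alpha>) powr real k * b powr (\<beta> - 1)"
          by (simp only: powr_powr powr_add[symmetric] add_diff_eq)
        then show ?thesis
          using b(2) z by (simp add: powr_realpow)
      qed
      then have "(2 * z + 1) ^ k * b powr (\<beta> - 1) * exp (- (b + 1)) \<le> Gamma (\<alpha> * real k + \<beta>)"
        using Gamma_lower_bound[OF b(1) s] by simp
      then have "z ^ k / Gamma (\<alpha> * real k + \<beta>)
          \<le> z ^ k / ((2 * z + 1) ^ k * b powr (\<beta> - 1) * exp (- (b + 1)))"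
        using z b(1) Gamma_real_pos[of "\<alpha> * real k + \<beta>"] s
        by (intro divide_left_mono mult_pos_pos) auto
      also have "\<dots> = C * (z / (2 * z + 1)) ^ k"
        by (simp add: C_def power_divide)
      finally show ?thesis
        using z Gamma_real_pos[of "\<alpha> * real k + \<beta>"] s by (simp add: less_imp_le)
    qed
    then show "eventually (\<lambda>k. norm (z ^ k / Gamma (\<alpha> * real k + \<beta>)) \<le> C * (z / (2 * z + 1)) ^ k) sequentially"
      by (auto simp: eventually_sequentially)
  qed
qed

lemma has_bochner_integral_laplace_powr:
  fixes s u :: real
  assumes s: "0 < s" and u: "0 < u"
  shows "has_bochner_integral lborel (\<lambda>x. indicator {0<..} x * (x powr (s - 1) * exp (- (u * x))))
    (Gamma s / u powr s)"
proof (rule has_bochner_integral_nn_integral)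
  let ?f = "\<lambda>x. indicator {0<..} x * (x powr (s - 1) * exp (- (u * x)))"
  have "ennreal (Gamma s) = (\<integral>\<^sup>+t. ennreal (indicator {0..} t * t powr (s - 1) / exp t) \<partial>lborel)"
    by (rule Gamma_conv_nn_integral_real[OF s])
  also have "\<dots> = ennreal u * (\<integral>\<^sup>+x. ennreal (indicator {0..} (0 + u * x) * (0 + u * x) powr (s - 1) / exp (0 + u * x)) \<partial>lborel)"
    using u by (subst nn_integral_real_affine[where c = u and t = 0]) auto
  also have "(\<integral>\<^sup>+x. ennreal (indicator {0..} (0 + u * x) * (0 + u * x) powr (s - 1) / exp (0 + u * x)) \<partial>lborel)
      = (\<integral>\<^sup>+x. ennreal (u powr (s - 1)) * ennreal (?f x) \<partial>lborel)"
    using u by (intro nn_integral_cong)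
      (auto simp: indicator_def powr_mult exp_minus zero_le_mult_iff field_simps ennreal_mult''[symmetric])
  also have "\<dots> = ennreal (u powr (s - 1)) * (\<integral>\<^sup>+x. ennreal (?f x) \<partial>lborel)"
    by (rule nn_integral_cmult) auto
  finally have eq: "ennreal (Gamma s) = ennreal (u powr s) * (\<integral>\<^sup>+x. ennreal (?f x) \<partial>lborel)"
    using u by (simp add: mult.assoc[symmetric] ennreal_mult''[symmetric] powr_diff)
  have "(\<integral>\<^sup>+x. ennreal (?f x) \<partial>lborel) = ennreal (1 / u powr s) * (ennreal (u powr s) * (\<integral>\<^sup>+x. ennreal (?f x) \<partial>lborel))"
    using u by (simp add: mult.assoc[symmetric] ennreal_mult''[symmetric])
  also have "\<dots> = ennreal (Gamma s / u powr s)"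
    unfolding eq[symmetric] using u by (simp add: ennreal_mult'[symmetric])
  finally show "(\<integral>\<^sup>+x. ennreal (?f x) \<partial>lborel) = ennreal (Gamma s / u powr s)" .
qed (use s Gamma_real_pos[of s] in \<open>auto simp: less_imp_le\<close>)

text \<open>For \<open>a k = \<lambda>\<^sup>k\<close> this is \<open>x\<^bsup>\<alpha>-1\<^esup> E\<^bsub>\<alpha>,\<alpha>\<^esub>(\<lambda> x\<^sup>\<alpha>)\<close>. A fractional phase-type density has the same form
  with \<open>a k = \<pi> T\<^sup>k (- T e)\<close>, and only the geometric growth of these numbers matters for its
  convergence, its continuity and its Laplace transform.\<close>

definition ml_series :: "real \<Rightarrow> (nat \<Rightarrow> real) \<Rightarrow> real \<Rightarrow> real" where
  "ml_series \<alpha> a x =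
     x powr (\<alpha> - 1) * (\<Sum>k. a k / Gamma (\<alpha> * real k + \<alpha>) * (x powr \<alpha>) ^ k)"

locale geometric_coefficients =
  fixes \<alpha> :: real and a :: "nat \<Rightarrow> real" and C K :: real
  assumes \<alpha>: "0 < \<alpha>" and K: "0 \<le> K" and bound: "\<And>k. \<bar>a k\<bar> \<le> C * K ^ k"
begin

lemma Gamma_pos: "0 < Gamma (\<alpha> * real k + \<alpha>)"
  using \<alpha> by (intro Gamma_real_pos) (auto intro: add_nonneg_pos)

lemma summable_norm_ml_series: "summable (\<lambda>k. norm (a k / Gamma (\<alpha> * real k + \<alpha>) * z ^ k))"
proof (rule summable_comparison_test')
  show "summable (\<lambda>k. C * ((K * \<bar>z\<bar>) ^ k / Gamma (\<alpha> * real k + \<alpha>)))"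
    using \<alpha> K by (intro summable_mult summable_mittag_leffler) auto
  fix k :: nat
  have "\<bar>a k\<bar> * \<bar>z\<bar> ^ k \<le> (C * K ^ k) * \<bar>z\<bar> ^ k"
    using bound by (intro mult_right_mono) auto
  then show "norm (norm (a k / Gamma (\<alpha> * real k + \<alpha>) * z ^ k))
      \<le> C * ((K * \<bar>z\<bar>) ^ k / Gamma (\<alpha> * real k + \<alpha>))"
    using Gamma_pos[of k]
    by (simp add: abs_mult power_abs power_mult_distrib divide_right_mono mult.assoc)
qed

lemma summable_ml_series: "summable (\<lambda>k. a k / Gamma (\<alpha> * real k + \<alpha>) * z ^ k)"
  by (rule summable_norm_cancel, rule summable_norm_ml_series)

lemma continuous_on_ml_series: "continuous_on {0<..} (ml_series \<alpha> a)"
proof -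
  define P where "P z = (\<Sum>k. a k / Gamma (\<alpha> * real k + \<alpha>) * z ^ k)" for z
  have "isCont P z" for z
    unfolding P_def
    by (rule isCont_powser_converges_everywhere, rule summable_ml_series)
  then have P: "continuous_on UNIV P"
    by (blast intro: continuous_at_imp_continuous_on)
  have powr: "continuous_on {0<..} (\<lambda>x::real. x powr r)" for r
    by (intro continuous_intros) auto
  have "continuous_on {0<..} (\<lambda>x. x powr (\<alpha> - 1) * P (x powr \<alpha>))"
    by (rule continuous_on_mult[OF powr continuous_on_compose2[OF P powr]]) simp
  then show ?thesis
    by (simp add: ml_series_def[abs_def] P_def)
qed

text \<open>The series may be integrated term by term because the integrals of the absolute values of its
  terms are bounded by a geometric series with ratio \<open>K / u\<^sup>\<alpha>\<close>.\<close>

lemma has_bochner_integral_laplace_ml_series: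
  assumes u: "0 < u" "K < u powr \<alpha>"
  shows "has_bochner_integral lborel (\<lambda>x. indicator {0<..} x * (ml_series \<alpha> a x * exp (- (u * x))))
    (\<Sum>k. a k / (u powr \<alpha>) ^ Suc k)"
proof -
  define s where "s k = \<alpha> * real k + \<alpha>" for k
  have s: "0 < s k" for k
    unfolding s_def using \<alpha> by (auto intro: add_nonneg_pos)
  define f where "f k x = a k / Gamma (s k) * (indicator {0<..} x * (x powr (s k - 1) * exp (- (u * x))))" for k x
  have u_powr: "u powr s k = (u powr \<alpha>) ^ Suc k" for k
  proof -
    have "u powr s k = (u powr \<alpha>) powr real (Suc k)"
      unfolding powr_powr by (simp add: s_def algebra_simps)
    then show ?thesis
      using u by (subst (asm) powr_realpow) auto
  qed
  have base: "has_bochner_integral lborel (\<lambda>x. indicator {0<..} x * (x powr (s k - 1) * exp (- (u * x))))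
      (Gamma (s k) / (u powr \<alpha>) ^ Suc k)" for k
    using has_bochner_integral_laplace_powr[OF s u(1), of k] by (simp only: u_powr)
  have scaled: "has_bochner_integral lborel
      (\<lambda>x. c / Gamma (s k) * (indicator {0<..} x * (x powr (s k - 1) * exp (- (u * x)))))
      (c / (u powr \<alpha>) ^ Suc k)" for c k
  proof -
    have "c / Gamma (s k) * (Gamma (s k) / (u powr \<alpha>) ^ Suc k) = c / (u powr \<alpha>) ^ Suc k"
      using Gamma_pos[of k] by (simp add: s_def)
    then show ?thesis
      using has_bochner_integral_mult_right[where c = "c / Gamma (s k)", OF base[of k]] by (simp only:)
  qed
  have f: "has_bochner_integral lborel (f k) (a k / (u powr \<alpha>) ^ Suc k)" for k
    unfolding f_def[abs_def] by (rule scaled)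
  have norm_f: "norm (f k x) = \<bar>a k\<bar> / Gamma (s k) * (indicator {0<..} x * (x powr (s k - 1) * exp (- (u * x))))" for k x
    using Gamma_pos[of k] by (simp add: f_def abs_mult s_def)
  have norm_int: "(\<integral>x. norm (f k x) \<partial>lborel) = \<bar>a k\<bar> / (u powr \<alpha>) ^ Suc k" for k
  proof -
    have "has_bochner_integral lborel (\<lambda>x. norm (f k x)) (\<bar>a k\<bar> / (u powr \<alpha>) ^ Suc k)"
      unfolding norm_f by (rule scaled)
    then show ?thesis
      by (rule has_bochner_integral_integral_eq)
  qed
  have factor: "f k x = indicator {0<..} x * x powr (\<alpha> - 1) * exp (- (u * x)) *
      (a k / Gamma (\<alpha> * real k + \<alpha>) * (x powr \<alpha>) ^ k)" for k x
  proof (cases "0 < x")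
    case True
    have "x powr (s k - 1) = (x powr \<alpha>) powr real k * x powr (\<alpha> - 1)"
      by (simp only: powr_powr powr_add[symmetric] add_diff_eq s_def)
    then have "x powr (s k - 1) = (x powr \<alpha>) ^ k * x powr (\<alpha> - 1)"
      using True by (simp add: powr_realpow)
    then show ?thesis
      by (simp add: f_def s_def)
  qed (simp add: f_def)
  have integrable: "integrable lborel (f k)" for k
    using f by (rule integrable.intros)
  have sum_pt: "AE x in lborel. summable (\<lambda>k. norm (f k x))"
    unfolding factor norm_mult by (intro AE_I2 summable_mult summable_norm_ml_series[unfolded norm_mult])
  have sum_int: "summable (\<lambda>k. \<integral>x. norm (f k x) \<partial>lborel)"
    unfolding norm_int
  proof (rule summable_comparison_test')
    show "summable (\<lambda>k. C / u powr \<alpha> * (K / u powr \<alpha>) ^ k)"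
      using u K by (intro summable_mult summable_geometric) auto
    fix k :: nat
    have "\<bar>a k\<bar> / (u powr \<alpha>) ^ Suc k \<le> C * K ^ k / (u powr \<alpha>) ^ Suc k"
      using bound by (intro divide_right_mono) auto
    then show "norm (\<bar>a k\<bar> / (u powr \<alpha>) ^ Suc k) \<le> C / u powr \<alpha> * (K / u powr \<alpha>) ^ k"
      by (simp add: power_divide)
  qed
  have eq: "(\<lambda>x. indicator {0<..} x * (ml_series \<alpha> a x * exp (- (u * x)))) = (\<lambda>x. \<Sum>k. f k x)"
  proof
    fix x
    show "indicator {0<..} x * (ml_series \<alpha> a x * exp (- (u * x))) = (\<Sum>k. f k x)"
      unfolding factor ml_series_def
      by (subst suminf_mult[OF summable_ml_series]) (simp only: mult_ac)
  qed
  show ?thesis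
    unfolding eq has_bochner_integral_iff
    using integrable_suminf[OF integrable sum_pt sum_int] integral_suminf[OF integrable sum_pt sum_int]
      has_bochner_integral_integral_eq[OF f] by simp
qed

end

section \<open>Laplace transforms determine atoms and signed densities\<close>

text \<open>In terms of \<open>y = exp (- x)\<close> the last assumption says that \<open>\<mu>\<close> and the signed measure
  \<open>c \<delta>\<^sub>0 + g dx\<close> have the same moments on the unit interval.\<close>

locale laplace_moments = finite_measure \<mu> for \<mu> :: "real measure" +
  fixes g :: "real \<Rightarrow> real" and c :: real
  assumes sets_mu: "sets \<mu> = sets borel"
    and nonneg: "AE x in \<mu>. 0 \<le> x"
    and g_integrable: "integrable lborel g"
    and g_zero: "\<And>x. x \<le> 0 \<Longrightarrow> g x = 0"
    and moments: "\<And>k::nat. (\<integral>x. exp (- (real k * x)) \<partial>\<mu>)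
      = c + (\<integral>x. exp (- (real k * x)) * g x \<partial>lborel)"
begin

text \<open>The difference between the integrals of \<open>h(exp (- x))\<close> with respect to \<open>\<mu>\<close> and to \<open>c \<delta>\<^sub>0 + g dx\<close>.
  Working with this functional avoids signed measures, and also the decomposition of \<open>g\<close> into its
  positive and its negative part.\<close>

definition defect :: "(real \<Rightarrow> real) \<Rightarrow> real" where
  "defect h = (\<integral>x. h (exp (- x)) \<partial>\<mu>) - c * h 1 - (\<integral>x. h (exp (- x)) * g x \<partial>lborel)"

lemma measurable_mu: "borel_measurable \<mu> = borel_measurable borel"
  by (rule measurable_cong_sets[OF sets_mu refl])

lemma g_measurable [measurable]: "g \<in> borel_measurable borel"
  using borel_measurable_integrable[OF g_integrable] by simp

lemma AE_bound:
  fixes h :: "real \<Rightarrow> real"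
  assumes "\<And>y. 0 \<le> y \<Longrightarrow> y \<le> 1 \<Longrightarrow> \<bar>h y\<bar> \<le> B"
  shows "AE x in \<mu>. norm (h (exp (- x))) \<le> B"
  using nonneg by eventually_elim (use assms in simp)

lemma norm_g_bound:
  fixes h :: "real \<Rightarrow> real"
  assumes "\<And>y. 0 \<le> y \<Longrightarrow> y \<le> 1 \<Longrightarrow> \<bar>h y\<bar> \<le> B"
  shows "norm (h (exp (- x)) * g x) \<le> B * \<bar>g x\<bar>"
proof (cases "x \<le> 0")
  case False
  then have "\<bar>h (exp (- x))\<bar> \<le> B"
    by (intro assms) auto
  then show ?thesis
    by (simp add: abs_mult mult_right_mono)
qed (simp add: g_zero)

lemma integrable_mu:
  fixes h :: "real \<Rightarrow> real"
  assumes [measurable]: "h \<in> borel_measurable borel"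
    and "\<And>y. 0 \<le> y \<Longrightarrow> y \<le> 1 \<Longrightarrow> \<bar>h y\<bar> \<le> B"
  shows "integrable \<mu> (\<lambda>x. h (exp (- x)))"
  by (rule integrable_const_bound[OF AE_bound[OF assms(2)]]) (auto simp: measurable_mu)

lemma integrable_g:
  fixes h :: "real \<Rightarrow> real"
  assumes [measurable]: "h \<in> borel_measurable borel"
    and "\<And>y. 0 \<le> y \<Longrightarrow> y \<le> 1 \<Longrightarrow> \<bar>h y\<bar> \<le> B"
  shows "integrable lborel (\<lambda>x. h (exp (- x)) * g x)"
proof (rule Bochner_Integration.integrable_bound)
  show "integrable lborel (\<lambda>x. B * \<bar>g x\<bar>)"
    using g_integrable by simp
  have "norm (h (exp (- x)) * g x) \<le> norm (B * \<bar>g x\<bar>)" for x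
    using norm_g_bound[where h = h and x = x, OF assms(2)] by simp
  then show "AE x in lborel. norm (h (exp (- x)) * g x) \<le> norm (B * \<bar>g x\<bar>)"
    by simp
qed simp

lemma abs_defect_le:
  fixes h :: "real \<Rightarrow> real"
  assumes h: "h \<in> borel_measurable borel"
    and B: "\<And>y. 0 \<le> y \<Longrightarrow> y \<le> 1 \<Longrightarrow> \<bar>h y\<bar> \<le> B"
  shows "\<bar>defect h\<bar> \<le> B * (measure \<mu> (space \<mu>) + \<bar>c\<bar> + (\<integral>x. \<bar>g x\<bar> \<partial>lborel))"
proof -
  have "\<bar>\<integral>x. h (exp (- x)) \<partial>\<mu>\<bar> \<le> (\<integral>x. norm (h (exp (- x))) \<partial>\<mu>)"
    using integral_norm_bound[of \<mu> "\<lambda>x. h (exp (- x))"] by simp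
  also have "\<dots> \<le> (\<integral>x. B \<partial>\<mu>)"
    by (intro integral_mono_AE integrable_norm integrable_mu[OF h B] AE_bound[OF B]) auto
  finally have 1: "\<bar>\<integral>x. h (exp (- x)) \<partial>\<mu>\<bar> \<le> B * measure \<mu> (space \<mu>)"
    by (simp add: mult.commute)
  have "\<bar>\<integral>x. h (exp (- x)) * g x \<partial>lborel\<bar> \<le> (\<integral>x. norm (h (exp (- x)) * g x) \<partial>lborel)"
    using integral_norm_bound[of lborel "\<lambda>x. h (exp (- x)) * g x"] by simp
  also have "\<dots> \<le> (\<integral>x. B * \<bar>g x\<bar> \<partial>lborel)"
    using g_integrable
    by (intro integral_mono integrable_norm integrable_g[OF h B] norm_g_bound[OF B]) auto
  finally have 2: "\<bar>\<integral>x. h (exp (- x)) * g x \<partial>lborel\<bar> \<le> B * (\<integral>x. \<bar>g x\<bar> \<partial>lborel)"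
    by simp
  have 3: "\<bar>c * h 1\<bar> \<le> B * \<bar>c\<bar>"
    using mult_left_mono[OF B[of 1] abs_ge_zero[of c]] by (simp add: abs_mult mult.commute)
  show ?thesis
    unfolding defect_def using 1 2 3 by (simp add: distrib_left abs_le_iff)
qed

lemma defect_diff:
  assumes h: "h \<in> borel_measurable borel" "\<And>y. 0 \<le> y \<Longrightarrow> y \<le> 1 \<Longrightarrow> \<bar>h y\<bar> \<le> B"
    and h': "h' \<in> borel_measurable borel" "\<And>y. 0 \<le> y \<Longrightarrow> y \<le> 1 \<Longrightarrow> \<bar>h' y\<bar> \<le> B'"
  shows "defect (\<lambda>y. h y - h' y) = defect h - defect h'"
  unfolding defect_def left_diff_distrib
  using integrable_mu[OF h] integrable_mu[OF h'] integrable_g[OF h] integrable_g[OF h']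
  by (simp add: right_diff_distrib)

lemma defect_polynomial: "defect (\<lambda>y. \<Sum>i\<le>n. a i * y ^ i) = 0"
proof -
  have pow: "exp (- x) ^ i = exp (- (real i * x))" for x i
    by (simp add: exp_of_nat_mult[symmetric])
  have unit: "\<bar>y ^ i\<bar> \<le> 1" if "0 \<le> y" "y \<le> 1" for y :: real and i
    using that by (simp add: power_le_one)
  have 1: "integrable \<mu> (\<lambda>x. exp (- x) ^ i)" for i
    by (rule integrable_mu[of "\<lambda>y. y ^ i" 1]) (use unit in auto)
  have 2: "integrable lborel (\<lambda>x. exp (- x) ^ i * g x)" for i
    by (rule integrable_g[of "\<lambda>y. y ^ i" 1]) (use unit in auto)
  have "(\<integral>x. (\<Sum>i\<le>n. a i * exp (- x) ^ i) \<partial>\<mu>) = (\<Sum>i\<le>n. a i * (\<integral>x. exp (- x) ^ i \<partial>\<mu>))"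
    using 1 by (subst Bochner_Integration.integral_sum) auto
  moreover have "(\<integral>x. (\<Sum>i\<le>n. a i * exp (- x) ^ i) * g x \<partial>lborel)
      = (\<Sum>i\<le>n. a i * (\<integral>x. exp (- x) ^ i * g x \<partial>lborel))"
    using 2 unfolding sum_distrib_right mult.assoc
    by (subst Bochner_Integration.integral_sum) auto
  ultimately show ?thesis
    unfolding defect_def pow moments
    by (simp add: sum.distrib distrib_left sum_distrib_left mult.commute)
qed

text \<open>The functional vanishes on polynomials and is bounded with respect to uniform convergence on the
  unit interval, where polynomials are dense among the continuous functions.\<close>

lemma defect_continuous:
  assumes h: "continuous_on UNIV h"
  shows "defect h = 0"
proof -
  have h_meas: "h \<in> borel_measurable borel"
    by (rule borel_measurable_continuous_onI[OF h])
  have h_cont: "continuous_on {0..1} h"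
    using h continuous_on_subset by blast
  obtain B where B: "\<And>y. 0 \<le> y \<Longrightarrow> y \<le> 1 \<Longrightarrow> \<bar>h y\<bar> \<le> B"
    using compact_imp_bounded[OF compact_continuous_image[OF h_cont compact_Icc]]
    unfolding bounded_iff by (metis atLeastAtMost_iff imageI real_norm_def)
  define D where "D = measure \<mu> (space \<mu>) + \<bar>c\<bar> + (\<integral>x. \<bar>g x\<bar> \<partial>lborel)"
  have "0 \<le> D"
    unfolding D_def by (intro add_nonneg_nonneg) auto
  have "\<bar>defect h\<bar> \<le> 0 + e" if "0 < e" for e
  proof -
    define \<epsilon> where "\<epsilon> = e / (D + 1)"
    have \<epsilon>: "0 < \<epsilon>" "\<epsilon> * D \<le> e"
      using that \<open>0 \<le> D\<close> by (auto simp: \<epsilon>_def field_simps)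
    obtain q where q: "real_polynomial_function q" "\<And>y. y \<in> {0..1} \<Longrightarrow> \<bar>h y - q y\<bar> < \<epsilon>"
      by (rule Stone_Weierstrass_real_polynomial_function[OF compact_Icc h_cont \<epsilon>(1)]) blast
    from q(1) obtain a n where q_eq: "q = (\<lambda>y. \<Sum>i\<le>n. a i * y ^ i)"
      unfolding real_polynomial_function_iff_sum by blast
    have q_meas: "q \<in> borel_measurable borel"
      unfolding q_eq by simp
    have q_bound: "\<bar>q y\<bar> \<le> B + \<epsilon>" if "0 \<le> y" "y \<le> 1" for y
      using B[OF that] q(2)[of y] that by simp
    have "defect h = defect (\<lambda>y. h y - q y)"
      using defect_diff[OF h_meas B q_meas q_bound] defect_polynomial[of a n] by (simp add: q_eq)
    also have "\<bar>\<dots>\<bar> \<le> \<epsilon> * D"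
      unfolding D_def
      by (rule abs_defect_le) (use h_meas q_meas q(2) in \<open>auto intro: less_imp_le\<close>)
    finally show ?thesis
      using \<epsilon>(2) by simp
  qed
  then have "\<bar>defect h\<bar> \<le> 0"
    by (rule field_le_epsilon)
  then show ?thesis
    by simp
qed

lemma cdf_eq: "measure \<mu> {..b} = c * indicator {..b} 0 + (\<integral>x. indicator {..b} x * g x \<partial>lborel)"
proof -
  \<comment> \<open>Continuous functions that decrease to the indicator of \<open>y \<ge> exp (- b)\<close>, that is, of \<open>x \<le> b\<close>.\<close>
  define h where "h m y = max 0 (min 1 (1 + real m * (y - exp (- b))))" for m y
  have h_cont: "continuous_on UNIV (h m)" for m
    unfolding h_def by (intro continuous_intros)
  have [measurable]: "h m \<in> borel_measurable borel" for m
    by (rule borel_measurable_continuous_onI[OF h_cont])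
  have h_bound: "\<bar>h m y\<bar> \<le> 1" for m y
    by (auto simp: h_def)
  have h_lim: "(\<lambda>m. h m (exp (- x))) \<longlonglongrightarrow> indicator {..b} x" for x
  proof (cases "x \<le> b")
    case True
    then have "h m (exp (- x)) = 1" for m
      by (auto simp: h_def min_def max_def)
    then show ?thesis
      using True by simp
  next
    case False
    define d where "d = exp (- b) - exp (- x)"
    have d: "0 < d"
      using False by (simp add: d_def)
    obtain N where N: "1 < real N * d"
      using reals_Archimedean3[OF d] by blast
    have "h m (exp (- x)) = 0" if "N \<le> m" for m
    proof -
      have "real N * d \<le> real m * d"
        using that d by (intro mult_right_mono) auto
      then have "1 + real m * (exp (- x) - exp (- b)) \<le> 0"
        using N unfolding d_def right_diff_distrib by linarith
      then show ?thesis
        by (simp add: h_def)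
    qed
    then have "\<forall>\<^sub>F m in sequentially. h m (exp (- x)) = 0"
      by (auto simp: eventually_sequentially)
    then show ?thesis
      using False by (simp add: tendsto_eventually)
  qed
  have A: "(\<lambda>m. \<integral>x. h m (exp (- x)) \<partial>\<mu>) \<longlonglongrightarrow> (\<integral>x. indicator {..b} x \<partial>\<mu>)"
    by (rule integral_dominated_convergence[where w = "\<lambda>_. 1"])
      (use h_lim h_bound in \<open>auto simp: measurable_mu\<close>)
  have B: "(\<lambda>m. \<integral>x. h m (exp (- x)) * g x \<partial>lborel) \<longlonglongrightarrow> (\<integral>x. indicator {..b} x * g x \<partial>lborel)"
  proof (rule integral_dominated_convergence[where w = "\<lambda>x. \<bar>g x\<bar>"])
    show "AE x in lborel. (\<lambda>m. h m (exp (- x)) * g x) \<longlonglongrightarrow> indicator {..b} x * g x"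
      by (intro AE_I2 tendsto_mult h_lim tendsto_const)
    show "AE x in lborel. norm (h m (exp (- x)) * g x) \<le> \<bar>g x\<bar>" for m
      using h_bound by (intro AE_I2) (simp add: abs_mult mult_left_le_one_le)
  qed (use g_integrable in auto)
  have C: "(\<lambda>m. c * h m 1) \<longlonglongrightarrow> c * indicator {..b} 0"
    using h_lim[of 0] by (intro tendsto_mult tendsto_const) simp
  have "(\<lambda>m. defect (h m)) \<longlonglongrightarrow> (\<integral>x. indicator {..b} x \<partial>\<mu>) - c * indicator {..b} 0
      - (\<integral>x. indicator {..b} x * g x \<partial>lborel)"
    unfolding defect_def by (intro tendsto_diff A B C)
  then have "(\<integral>x. indicator {..b} x \<partial>\<mu>) - c * indicator {..b} 0
      - (\<integral>x. indicator {..b} x * g x \<partial>lborel) = 0"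
    unfolding defect_continuous[OF h_cont] by (rule LIMSEQ_unique[OF _ tendsto_const])
  moreover have "(\<integral>x. indicator {..b} x \<partial>\<mu>) = measure \<mu> {..b}"
    using sets_eq_imp_space_eq[OF sets_mu] by simp
  ultimately show ?thesis
    by simp
qed

end

context laplace_moments begin

lemma sets_mu_iff: "A \<in> sets \<mu> \<longleftrightarrow> A \<in> sets borel"
  by (simp add: sets_mu)

lemma measure_singleton_0: "measure \<mu> {0} = c"
proof -
  have "measure \<mu> {0} = measure \<mu> {..0}"
  proof (rule measure_eq_AE)
    show "AE x in \<mu>. x \<in> {0} \<longleftrightarrow> x \<in> {..0}"
      using nonneg by eventually_elim auto
  qed (auto simp: sets_mu_iff)
  also have "\<dots> = c + (\<integral>x. indicator {..0} x * g x \<partial>lborel)"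
    using cdf_eq[of 0] by simp
  also have "(\<lambda>x. indicator {..0} x * g x) = (\<lambda>x. 0)"
    using g_zero by (auto simp: indicator_def)
  finally show ?thesis
    by simp
qed

lemma integrable_indicator_g:
  "A \<in> sets borel \<Longrightarrow> integrable lborel (\<lambda>x. indicator A x * g x)"
  using integrable_mult_indicator[of A lborel g] g_integrable by simp

lemma measure_greaterThanAtMost:
  assumes "0 \<le> a" "a \<le> b"
  shows "measure \<mu> {a<..b} = (\<integral>x. indicator {a<..b} x * g x \<partial>lborel)"
proof -
  have "measure \<mu> {..b} = measure \<mu> ({..a} \<union> {a<..b})"
    using assms by (simp add: ivl_disj_un)
  also have "\<dots> = measure \<mu> {..a} + measure \<mu> {a<..b}"
    by (rule finite_measure_Union) (auto simp: sets_mu_iff)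
  finally have "measure \<mu> {a<..b} = measure \<mu> {..b} - measure \<mu> {..a}"
    by simp
  also have "\<dots> = (\<integral>x. indicator {..b} x * g x \<partial>lborel) - (\<integral>x. indicator {..a} x * g x \<partial>lborel)"
    using assms by (simp add: cdf_eq)
  also have "\<dots> = (\<integral>x. indicator {..b} x * g x - indicator {..a} x * g x \<partial>lborel)"
    by (rule Bochner_Integration.integral_diff[symmetric]) (auto intro: integrable_indicator_g)
  also have "(\<lambda>x. indicator {..b} x * g x - indicator {..a} x * g x) = (\<lambda>x. indicator {a<..b} x * g x)"
    using assms by (auto simp: indicator_def)
  finally show ?thesis .
qed

text \<open>If \<open>g\<close> were negative at a point, then by continuity it would be bounded away from zero on a short
  interval to the right of it, and that interval would have negative measure.\<close>

lemma g_nonneg: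
  assumes cont: "continuous_on {0<..} g"
  shows "0 \<le> g x"
proof (rule ccontr)
  assume neg: "\<not> 0 \<le> g x"
  then have x: "0 < x"
    using g_zero[of x] by (cases "x \<le> 0") auto
  have "isCont g x"
    using cont x by (simp add: continuous_on_eq_continuous_at)
  then have "\<forall>\<^sub>F y in at x. g y < g x / 2"
    unfolding isCont_def using neg by (intro order_tendstoD(2)) auto
  then obtain e where e: "0 < e" "\<And>y. y \<noteq> x \<Longrightarrow> dist y x < e \<Longrightarrow> g y < g x / 2"
    unfolding eventually_at by blast
  define b where "b = x + e / 2"
  have lt: "g y \<le> g x / 2" if "y \<in> {x<..b}" for y
    using e(2)[of y] e(1) that by (auto simp: b_def dist_real_def)
  have xb: "x < b"
    using e(1) by (simp add: b_def)
  have "0 \<le> measure \<mu> {x<..b}"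
    by simp
  also have "\<dots> = (\<integral>y. indicator {x<..b} y * g y \<partial>lborel)"
    using x xb by (intro measure_greaterThanAtMost) auto
  also have "\<dots> \<le> (\<integral>y. indicator {x<..b} y * (g x / 2) \<partial>lborel)"
  proof (rule integral_mono)
    show "integrable lborel (\<lambda>y. indicator {x<..b} y * g y)"
      by (rule integrable_indicator_g) simp
    show "integrable lborel (\<lambda>y. indicator {x<..b} y * (g x / 2))"
      by (rule integrable_mult_left) (use xb in \<open>simp add: integrable_indicator_iff\<close>)
    show "indicator {x<..b} y * g y \<le> indicator {x<..b} y * (g x / 2)" for y
      using lt[of y] by (cases "y \<in> {x<..b}") simp_all
  qed
  also have "\<dots> = (b - x) * (g x / 2)"
    using xb by simp
  also have "\<dots> < 0"
    using xb neg by (intro mult_pos_neg) auto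
  finally show False
    by simp
qed

text \<open>Both sides are finite on the half-lines \<open>{..b}\<close>, which generate the Borel sets.\<close>

lemma density_eq:
  assumes cont: "continuous_on {0<..} g"
  shows "density \<mu> (indicator {0<..}) = density lborel (\<lambda>x. ennreal (g x))"
proof (rule measure_eqI_generator_eq[where E = "range atMost" and \<Omega> = UNIV and A = "\<lambda>n. {..real n}"])
  show "Int_stable (range (atMost :: real \<Rightarrow> real set))"
    by (auto simp: Int_stable_def)
  show "sets (density \<mu> (indicator {0<..})) = sigma_sets UNIV (range atMost)"
    by (simp add: sets_mu borel_eq_atMost)
  show "sets (density lborel (\<lambda>x. ennreal (g x))) = sigma_sets UNIV (range atMost)"
    by (simp add: borel_eq_atMost)
  show "(\<Union>n. {..real n}) = UNIV"
    using real_arch_simple by auto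
  have mu: "emeasure (density \<mu> (indicator {0<..})) {..b} = emeasure \<mu> {0<..b}" for b
  proof -
    have eq: "(\<lambda>x. indicator {0<..} x * indicator {..b} x) = (indicator {0<..b} :: real \<Rightarrow> ennreal)"
      by (auto simp: fun_eq_iff split: split_indicator)
    show ?thesis
      by (subst emeasure_density) (simp_all add: measurable_mu sets_mu_iff eq)
  qed
  show "emeasure (density \<mu> (indicator {0<..})) {..real n} \<noteq> \<infinity>" for n
    unfolding mu by simp
  show "emeasure (density \<mu> (indicator {0<..})) X = emeasure (density lborel (\<lambda>x. ennreal (g x))) X"
    if X: "X \<in> range atMost" for X
  proof -
    from X obtain b where b: "X = {..b}"
      by auto
    have dens: "emeasure (density lborel (\<lambda>x. ennreal (g x))) {..b}
        = (\<integral>\<^sup>+x. ennreal (indicator {0<..b} x * g x) \<partial>lborel)"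
      by (subst emeasure_density) (auto simp: g_zero intro!: nn_integral_cong split: split_indicator)
    also have "\<dots> = ennreal (\<integral>x. indicator {0<..b} x * g x \<partial>lborel)"
      using g_nonneg[OF cont] by (intro nn_integral_eq_integral integrable_indicator_g) auto
    also have "\<dots> = emeasure \<mu> {0<..b}"
    proof (cases "0 \<le> b")
      case True
      then show ?thesis
        using measure_greaterThanAtMost[of 0 b] by (simp add: emeasure_eq_measure)
    qed simp
    finally show ?thesis
      unfolding b mu by simp
  qed
qed auto

end

text \<open>Tilting \<open>\<mu>\<close> and \<open>f\<close> by \<open>exp (- u\<^sub>0 x)\<close> makes \<open>f\<close> integrable and moves the points
  \<open>u\<^sub>0, u\<^sub>0 + 1, u\<^sub>0 + 2, \<dots>\<close> to the natural numbers. The values of the transforms at these points are the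
  moments in \<^locale>\<open>laplace_moments\<close>, and the tilting is undone afterwards.\<close>

lemma laplace_transform_determines_law:
  fixes \<mu> :: "real measure" and f :: "real \<Rightarrow> real" and c u\<^sub>0 :: real
  assumes \<mu>: "finite_measure \<mu>" "sets \<mu> = sets borel" "AE x in \<mu>. 0 \<le> x"
    and u\<^sub>0: "0 \<le> u\<^sub>0"
    and cont: "continuous_on {0<..} f"
    and int: "integrable lborel (\<lambda>x. indicator {0<..} x * (f x * exp (- (u\<^sub>0 * x))))"
    and transform: "\<And>u. u\<^sub>0 \<le> u \<Longrightarrow> (\<integral>x. exp (- (u * x)) \<partial>\<mu>)
      = c + (\<integral>x. indicator {0<..} x * (f x * exp (- (u * x))) \<partial>lborel)"
  shows "\<And>x. 0 < x \<Longrightarrow> 0 \<le> f x"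
    and "\<And>A. A \<in> sets borel \<Longrightarrow> emeasure \<mu> A = ennreal c * indicator A 0
        + emeasure (density lborel (\<lambda>x. ennreal (indicator {0<..} x * f x))) A"
proof -
  interpret finite_measure \<mu>
    by (rule \<mu>(1))
  have meas: "borel_measurable \<mu> = borel_measurable borel"
    by (rule measurable_cong_sets[OF \<mu>(2) refl])
  define e where "e x = exp (- (u\<^sub>0 * x))" for x
  have e_pos: "0 < e x" for x
    by (simp add: e_def)
  have [measurable]: "e \<in> borel_measurable borel"
    by (simp add: e_def[abs_def])
  define \<nu> where "\<nu> = density \<mu> (\<lambda>x. ennreal (e x))"
  define g where "g x = indicator {0<..} x * (f x * e x)" for x
  have \<nu>_finite: "finite_measure \<nu>"
  proof
    have "emeasure \<nu> (space \<nu>) = (\<integral>\<^sup>+x. ennreal (e x) \<partial>\<mu>)"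
      unfolding \<nu>_def by (subst emeasure_density) (auto simp: meas intro!: nn_integral_cong)
    also have "\<dots> \<le> (\<integral>\<^sup>+x. 1 \<partial>\<mu>)"
      using \<mu>(3) u\<^sub>0 by (intro nn_integral_mono_AE) (auto simp: e_def elim!: eventually_mono)
    finally show "emeasure \<nu> (space \<nu>) \<noteq> \<infinity>"
      using emeasure_finite[of "space \<mu>"] by (auto simp: top_unique)
  qed
  interpret nu: laplace_moments \<nu> g c
  proof (intro laplace_moments.intro laplace_moments_axioms.intro)
    show "finite_measure \<nu>"
      by (rule \<nu>_finite)
    show "sets \<nu> = sets borel"
      by (simp add: \<nu>_def \<mu>(2))
    show "AE x in \<nu>. 0 \<le> x"
      unfolding \<nu>_def using \<mu>(3) by (subst AE_density) (auto simp: meas)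
    show "integrable lborel g"
      using int by (simp add: g_def[abs_def] e_def)
    show "g x = 0" if "x \<le> 0" for x
      using that by (simp add: g_def)
    fix k :: nat
    have split: "exp (- ((u\<^sub>0 + real k) * x)) = e x * exp (- (real k * x))" for x
      by (simp add: e_def distrib_right exp_add[symmetric])
    have "(\<integral>x. exp (- (real k * x)) \<partial>\<nu>) = (\<integral>x. exp (- ((u\<^sub>0 + real k) * x)) \<partial>\<mu>)"
      unfolding \<nu>_def split using e_pos
      by (subst integral_density) (auto simp: meas less_imp_le)
    also have "\<dots> = c + (\<integral>x. exp (- (real k * x)) * g x \<partial>lborel)"
    proof -
      have "indicator {0<..} x * (f x * exp (- ((u\<^sub>0 + real k) * x))) = exp (- (real k * x)) * g x" for x
        unfolding split g_def by (simp only: mult_ac)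
      then show ?thesis
        using transform[of "u\<^sub>0 + real k"] by (simp only: of_nat_0_le_iff le_add_same_cancel1)
    qed
    finally show "(\<integral>x. exp (- (real k * x)) \<partial>\<nu>) = c + (\<integral>x. exp (- (real k * x)) * g x \<partial>lborel)" .
  qed
  have g_cont: "continuous_on {0<..} g"
  proof -
    have "continuous_on {0<..} (\<lambda>x. f x * e x)"
      unfolding e_def by (intro continuous_intros cont)
    then show ?thesis
      by (rule continuous_on_eq) (simp add: g_def)
  qed
  show f_nonneg: "0 \<le> f x" if "0 < x" for x
    using nu.g_nonneg[OF g_cont, of x] that e_pos[of x] by (simp add: g_def zero_le_mult_iff)
  have g_exp: "g x * exp (u\<^sub>0 * x) = indicator {0<..} x * f x" for x
    by (simp add: g_def e_def exp_minus)
  have f_meas: "(\<lambda>x. indicator {0<..} x * f x) \<in> borel_measurable borel"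
    unfolding g_exp[symmetric] by measurable
  have inv: "ennreal (e x) * ennreal (exp (u\<^sub>0 * x)) = 1" for x
    by (simp add: e_def ennreal_mult''[symmetric] exp_minus)
  have m_ind: "(indicator {0<..} :: real \<Rightarrow> ennreal) \<in> borel_measurable \<mu>"
    and m_e: "(\<lambda>x. ennreal (e x)) \<in> borel_measurable \<mu>"
    and m_exp: "(\<lambda>x. ennreal (exp (u\<^sub>0 * x))) \<in> borel_measurable \<mu>"
    unfolding meas by measurable
  have pos_part: "density \<mu> (indicator {0<..}) = density lborel (\<lambda>x. ennreal (indicator {0<..} x * f x))"
  proof -
    have "density (density \<nu> (indicator {0<..})) (\<lambda>x. ennreal (exp (u\<^sub>0 * x)))
        = density \<mu> (\<lambda>x. ennreal (e x) * indicator {0<..} x * ennreal (exp (u\<^sub>0 * x)))"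
      unfolding \<nu>_def density_density_eq[OF m_e m_ind]
      by (rule density_density_eq[OF borel_measurable_times_ennreal[OF m_e m_ind] m_exp])
    also have "(\<lambda>x. ennreal (e x) * indicator {0<..} x * ennreal (exp (u\<^sub>0 * x))) = indicator {0<..}"
    proof
      fix x
      have "ennreal (e x) * indicator {0<..} x * ennreal (exp (u\<^sub>0 * x))
          = (ennreal (e x) * ennreal (exp (u\<^sub>0 * x))) * indicator {0<..} x"
        by (simp only: mult_ac)
      then show "ennreal (e x) * indicator {0<..} x * ennreal (exp (u\<^sub>0 * x)) = indicator {0<..} x"
        by (simp only: inv mult_1)
    qed
    finally have "density \<mu> (indicator {0<..})
        = density (density \<nu> (indicator {0<..})) (\<lambda>x. ennreal (exp (u\<^sub>0 * x)))" ..
    also have "\<dots> = density (density lborel (\<lambda>x. ennreal (g x))) (\<lambda>x. ennreal (exp (u\<^sub>0 * x)))"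
      by (simp only: nu.density_eq[OF g_cont])
    also have "\<dots> = density lborel (\<lambda>x. ennreal (indicator {0<..} x * f x))"
    proof -
      have "density (density lborel (\<lambda>x. ennreal (g x))) (\<lambda>x. ennreal (exp (u\<^sub>0 * x)))
          = density lborel (\<lambda>x. ennreal (g x) * ennreal (exp (u\<^sub>0 * x)))"
        by (rule density_density_eq) measurable
      then show ?thesis
        by (simp add: ennreal_mult''[symmetric] g_exp)
    qed
    finally show ?thesis .
  qed
  have zero: "emeasure \<mu> {0} = ennreal c"
  proof -
    have "emeasure \<nu> {0} = (\<integral>\<^sup>+x. ennreal (e x) * indicator {0} x \<partial>\<mu>)"
      unfolding \<nu>_def by (rule emeasure_density[OF m_e]) (simp add: \<mu>(2))
    also have "\<dots> = (\<integral>\<^sup>+x. indicator {0} x \<partial>\<mu>)"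
      by (intro nn_integral_cong) (simp add: e_def split: split_indicator)
    also have "\<dots> = emeasure \<mu> {0}"
      by (simp add: \<mu>(2))
    finally have "emeasure \<nu> {0} = emeasure \<mu> {0}" .
    then show ?thesis
      using nu.measure_singleton_0 nu.emeasure_eq_measure by metis
  qed
  show "emeasure \<mu> A = ennreal c * indicator A 0
        + emeasure (density lborel (\<lambda>x. ennreal (indicator {0<..} x * f x))) A" if A: "A \<in> sets borel" for A
  proof -
    have "emeasure \<mu> A = (\<integral>\<^sup>+x. indicator A x \<partial>\<mu>)"
      using A by (simp add: \<mu>(2))
    also have "\<dots> = (\<integral>\<^sup>+x. indicator A 0 * indicator {0} x + indicator {0<..} x * indicator A x \<partial>\<mu>)"
    proof (rule nn_integral_cong_AE)
      show "AE x in \<mu>. indicator A x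
          = (indicator A 0 * indicator {0} x + indicator {0<..} x * indicator A x :: ennreal)"
        using \<mu>(3) by eventually_elim (auto split: split_indicator)
    qed
    also have "\<dots> = indicator A 0 * emeasure \<mu> {0} + emeasure (density \<mu> (indicator {0<..})) A"
    proof -
      have m_A: "(indicator A :: real \<Rightarrow> ennreal) \<in> borel_measurable \<mu>"
        and m_0: "(indicator {0} :: real \<Rightarrow> ennreal) \<in> borel_measurable \<mu>"
        unfolding meas using A by simp_all
      have "(\<integral>\<^sup>+x. indicator A 0 * indicator {0} x \<partial>\<mu>) = indicator A 0 * emeasure \<mu> {0}"
        by (rule nn_integral_cmult_indicator) (simp add: \<mu>(2))
      moreover have "emeasure (density \<mu> (indicator {0<..})) A
          = (\<integral>\<^sup>+x. indicator {0<..} x * indicator A x \<partial>\<mu>)"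
        by (rule emeasure_density[OF m_ind]) (simp add: \<mu>(2) A)
      ultimately show ?thesis
        using nn_integral_add[OF borel_measurable_times_ennreal[OF borel_measurable_const m_0]
            borel_measurable_times_ennreal[OF m_ind m_A], of "indicator A 0"] by simp
    qed
    finally show ?thesis
      unfolding zero pos_part by (simp add: mult.commute)
  qed
qed

section \<open>Fractional phase-type densities\<close>

definition abs_sum :: "nat \<Rightarrow> real mat \<Rightarrow> real" where
  "abs_sum n A = (\<Sum>i<n. \<Sum>j<n. \<bar>A $$ (i, j)\<bar>)"

lemma abs_sum_nonneg: "0 \<le> abs_sum n A"
  unfolding abs_sum_def by (intro sum_nonneg) auto

lemma abs_pow_mat_le:
  assumes A: "A \<in> carrier_mat n n" and i: "i < n" and j: "j < n"
  shows "\<bar>(A ^\<^sub>m k) $$ (i, j)\<bar> \<le> abs_sum n A ^ k"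
  using j
proof (induction k arbitrary: j)
  case 0
  then show ?case
    using A i by auto
next
  case (Suc k)
  have P: "A ^\<^sub>m k \<in> carrier_mat n n"
    using A by (rule pow_carrier_mat)
  have "(A ^\<^sub>m Suc k) $$ (i, j) = (\<Sum>l<n. (A ^\<^sub>m k) $$ (i, l) * A $$ (l, j))"
    using A P i Suc.prems by (simp add: scalar_prod_def atLeast0LessThan)
  also have "\<bar>\<dots>\<bar> \<le> (\<Sum>l<n. abs_sum n A ^ k * \<bar>A $$ (l, j)\<bar>)"
    by (intro order_trans[OF sum_abs] sum_mono) (auto simp: abs_mult intro!: mult_right_mono Suc.IH)
  also have "\<dots> \<le> abs_sum n A ^ k * abs_sum n A"
    unfolding sum_distrib_left[symmetric] abs_sum_def[of n A]
    using Suc.prems abs_sum_nonneg[of n A]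
    by (intro mult_left_mono sum_mono member_le_sum[of j "{..<n}"]) (auto simp: abs_sum_def)
  finally show ?case
    by (simp add: mult.commute)
qed

text \<open>The powers \<open>A ^\<^sub>m k\<close> are defined by multiplication with \<open>A\<close> from the right, so that moving a
  factor to the front takes an induction.\<close>

lemma mult_pow_mat_vec:
  fixes A :: "real mat"
  assumes A: "A \<in> carrier_mat n n" and t: "t \<in> carrier_vec n"
  shows "A *\<^sub>v (A ^\<^sub>m k *\<^sub>v t) = A ^\<^sub>m Suc k *\<^sub>v t"
  using t
proof (induction k arbitrary: t)
  case 0
  then show ?case
    using A by simp
next
  case (Suc k)
  have P: "A ^\<^sub>m k \<in> carrier_mat n n"
    using A by (rule pow_carrier_mat)
  have At: "A *\<^sub>v t \<in> carrier_vec n"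
    using A Suc.prems by simp
  have step: "A ^\<^sub>m Suc m *\<^sub>v t = A ^\<^sub>m m *\<^sub>v (A *\<^sub>v t)" for m
    unfolding pow_mat.simps by (rule assoc_mult_mat_vec[OF pow_carrier_mat[OF A] A Suc.prems])
  show ?case
    unfolding step by (rule Suc.IH[OF At, unfolded step])
qed

lemma pow_smult_mat:
  fixes A :: "real mat"
  assumes A: "A \<in> carrier_mat n n"
  shows "(c \<cdot>\<^sub>m A) ^\<^sub>m k = c ^ k \<cdot>\<^sub>m (A ^\<^sub>m k)"
proof (induction k)
  case 0
  then show ?case
    using A by auto
next
  case (Suc k)
  have P: "A ^\<^sub>m k \<in> carrier_mat n n"
    using A by (rule pow_carrier_mat)
  have cA: "c \<cdot>\<^sub>m A \<in> carrier_mat n n"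
    using A by simp
  have "(c ^ k \<cdot>\<^sub>m (A ^\<^sub>m k)) * (c \<cdot>\<^sub>m A) = c ^ k \<cdot>\<^sub>m (A ^\<^sub>m k * (c \<cdot>\<^sub>m A))"
    by (rule mult_smult_assoc_mat[OF P cA])
  also have "\<dots> = c ^ k \<cdot>\<^sub>m (c \<cdot>\<^sub>m (A ^\<^sub>m k * A))"
    by (simp only: mult_smult_distrib[OF P A])
  also have "\<dots> = c ^ Suc k \<cdot>\<^sub>m (A ^\<^sub>m k * A)"
    by (intro eq_matI) auto
  finally show ?case
    by (simp only: pow_mat.simps Suc.IH)
qed

lemma scalar_prod_mult_mat_vec_sum:
  fixes A :: "real mat"
  assumes "A \<in> carrier_mat n n" "x \<in> carrier_vec n" "y \<in> carrier_vec n"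
  shows "x \<bullet> (A *\<^sub>v y) = (\<Sum>i<n. \<Sum>j<n. x $ i * y $ j * A $$ (i, j))"
proof -
  have "x \<bullet> (A *\<^sub>v y) = (\<Sum>i<n. x $ i * (A *\<^sub>v y) $ i)"
    using assms by (simp add: scalar_prod_def atLeast0LessThan del: index_mult_mat_vec)
  also have "\<dots> = (\<Sum>i<n. \<Sum>j<n. x $ i * y $ j * A $$ (i, j))"
    by (intro sum.cong refl) (simp add: index_mult_mat_vec_sum[OF assms(1,3)] sum_distrib_left mult_ac
        del: index_mult_mat_vec)
  finally show ?thesis .
qed

locale fractional_ph =
  fixes n :: nat and \<alpha> :: real and \<pi> :: "real vec" and T :: "real mat"
  assumes \<alpha>: "0 < \<alpha>" and \<pi>: "\<pi> \<in> carrier_vec n" and T: "sub_intensity n T"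
begin

definition exit :: "real vec" where
  "exit = - (T *\<^sub>v ones n)"

definition coeff :: "nat \<Rightarrow> real" where
  "coeff k = \<pi> \<bullet> (T ^\<^sub>m k *\<^sub>v exit)"

definition coeff_bound :: real where
  "coeff_bound = (\<Sum>i<n. \<Sum>j<n. \<bar>\<pi> $ i * exit $ j\<bar>)"

lemma T_carrier: "T \<in> carrier_mat n n"
  using T by (simp add: sub_intensity_def)

lemma exit_carrier: "exit \<in> carrier_vec n"
  using T_carrier by (simp add: exit_def ones_def)

lemma pow_carrier: "T ^\<^sub>m k \<in> carrier_mat n n"
  using T_carrier by (rule pow_carrier_mat)

lemma coeff_eq_sum: "coeff k = (\<Sum>i<n. \<Sum>j<n. \<pi> $ i * exit $ j * (T ^\<^sub>m k) $$ (i, j))"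
  unfolding coeff_def by (rule scalar_prod_mult_mat_vec_sum[OF pow_carrier \<pi> exit_carrier])

sublocale geometric_coefficients \<alpha> coeff coeff_bound "abs_sum n T"
proof
  fix k
  have "\<bar>coeff k\<bar> \<le> (\<Sum>i<n. \<Sum>j<n. \<bar>\<pi> $ i * exit $ j\<bar> * abs_sum n T ^ k)"
    unfolding coeff_eq_sum
    by (intro order_trans[OF sum_abs] sum_mono)
      (auto simp: abs_mult intro!: mult_left_mono abs_pow_mat_le[OF T_carrier])
  then show "\<bar>coeff k\<bar> \<le> coeff_bound * abs_sum n T ^ k"
    by (simp add: coeff_bound_def sum_distrib_right)
qed (use \<alpha> abs_sum_nonneg in auto)

lemma ph_density_eq_ml_series: "ph_density \<alpha> \<pi> T x = ml_series \<alpha> coeff x"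
proof -
  define z where "z = x powr \<alpha>"
  define G where "G k = Gamma (\<alpha> * real k + \<alpha>)" for k
  have M: "mittag_leffler_mat \<alpha> \<alpha> (z \<cdot>\<^sub>m T) \<in> carrier_mat n n"
    using T_carrier by (simp add: mittag_leffler_mat_def)
  have entry: "mittag_leffler_mat \<alpha> \<alpha> (z \<cdot>\<^sub>m T) $$ (i, j) = (\<Sum>k. (T ^\<^sub>m k) $$ (i, j) / G k * z ^ k)"
    if "i < n" "j < n" for i j
    using that T_carrier pow_carrier
    by (simp add: mittag_leffler_mat_def pow_smult_mat[OF T_carrier] G_def mult.commute)
  have summ: "summable (\<lambda>k. (T ^\<^sub>m k) $$ (i, j) / G k * z ^ k)" if "i < n" "j < n" for i j
  proof -
    interpret entry: geometric_coefficients \<alpha> "\<lambda>k. (T ^\<^sub>m k) $$ (i, j)" 1 "abs_sum n T"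
      using \<alpha> abs_sum_nonneg abs_pow_mat_le[OF T_carrier that] by unfold_locales auto
    show ?thesis
      unfolding G_def by (rule entry.summable_ml_series)
  qed
  have "\<pi> \<bullet> (mittag_leffler_mat \<alpha> \<alpha> (z \<cdot>\<^sub>m T) *\<^sub>v exit)
      = (\<Sum>i<n. \<Sum>j<n. \<pi> $ i * exit $ j * (\<Sum>k. (T ^\<^sub>m k) $$ (i, j) / G k * z ^ k))"
    by (simp add: scalar_prod_mult_mat_vec_sum[OF M \<pi> exit_carrier] entry)
  also have "\<dots> = (\<Sum>i<n. \<Sum>j<n. \<Sum>k. \<pi> $ i * exit $ j * ((T ^\<^sub>m k) $$ (i, j) / G k * z ^ k))"
    by (intro sum.cong refl suminf_mult[symmetric] summ) auto
  also have "\<dots> = (\<Sum>i<n. \<Sum>k. \<Sum>j<n. \<pi> $ i * exit $ j * ((T ^\<^sub>m k) $$ (i, j) / G k * z ^ k))"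
    by (intro sum.cong refl suminf_sum[symmetric] summable_mult summ) auto
  also have "\<dots> = (\<Sum>k. \<Sum>i<n. \<Sum>j<n. \<pi> $ i * exit $ j * ((T ^\<^sub>m k) $$ (i, j) / G k * z ^ k))"
    by (intro suminf_sum[symmetric] summable_sum summable_mult summ) auto
  also have "\<dots> = (\<Sum>k. coeff k / G k * z ^ k)"
    by (intro suminf_cong) (simp add: coeff_eq_sum sum_divide_distrib sum_distrib_right mult.assoc)
  finally show ?thesis
    using T_carrier by (simp add: ph_density_def ml_series_def z_def G_def exit_def)
qed

text \<open>The Neumann series \<open>z\<close> of the resolvent satisfies the same linear system as \<open>y\<close>, as one sees by
  shifting the index, and the M-matrix \<open>s - T\<close> admits only one solution.\<close>

lemma resolvent_eq_series:
  assumes s: "abs_sum n T < s" and y: "y \<in> carrier_vec n"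
    and eq: "\<And>i. i < n \<Longrightarrow> (T *\<^sub>v y) $ i = s * y $ i + (T *\<^sub>v ones n) $ i"
  shows "\<pi> \<bullet> y = (\<Sum>k. coeff k / s ^ Suc k)"
proof -
  have s_pos: "0 < s"
    using s abs_sum_nonneg[of n T] by linarith
  define v where "v k = T ^\<^sub>m k *\<^sub>v exit" for k
  have v: "v k \<in> carrier_vec n" for k
    unfolding v_def by (rule mult_mat_vec_carrier[OF pow_carrier exit_carrier])
  have summ_T: "summable (\<lambda>k. (T ^\<^sub>m k) $$ (i, j) / s ^ Suc k)" if "i < n" "j < n" for i j
  proof (rule summable_comparison_test')
    show "summable (\<lambda>k. 1 / s * (abs_sum n T / s) ^ k)"
      using s s_pos abs_sum_nonneg[of n T] by (intro summable_mult summable_geometric) auto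
    show "norm ((T ^\<^sub>m k) $$ (i, j) / s ^ Suc k) \<le> 1 / s * (abs_sum n T / s) ^ k" for k
      using divide_right_mono[OF abs_pow_mat_le[OF T_carrier that, of k], of "s ^ Suc k"] s_pos
      by (simp add: power_divide)
  qed
  have v_index: "v k $ i = (\<Sum>j<n. (T ^\<^sub>m k) $$ (i, j) * exit $ j)" if "i < n" for k i
    unfolding v_def by (rule index_mult_mat_vec_sum[OF pow_carrier exit_carrier that])
  have summ: "summable (\<lambda>k. v k $ i / s ^ Suc k)" if "i < n" for i
  proof -
    have "summable (\<lambda>k. \<Sum>j<n. exit $ j * ((T ^\<^sub>m k) $$ (i, j) / s ^ Suc k))"
      using that by (intro summable_sum summable_mult summ_T) auto
    then show ?thesis
      using that by (simp add: v_index sum_divide_distrib mult.commute)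
  qed
  define z where "z = vec n (\<lambda>i. \<Sum>k. v k $ i / s ^ Suc k)"
  have z: "z \<in> carrier_vec n"
    by (simp add: z_def)
  have Tz: "(T *\<^sub>v z) $ i = s * z $ i + (T *\<^sub>v ones n) $ i" if i: "i < n" for i
  proof -
    have "(T *\<^sub>v z) $ i = (\<Sum>j<n. \<Sum>k. T $$ (i, j) * (v k $ j / s ^ Suc k))"
      unfolding index_mult_mat_vec_sum[OF T_carrier z i]
      by (intro sum.cong refl) (simp add: z_def suminf_mult[OF summ] del: power_Suc times_divide_eq_right)
    also have "\<dots> = (\<Sum>k. \<Sum>j<n. T $$ (i, j) * (v k $ j / s ^ Suc k))"
      by (intro suminf_sum[symmetric] summable_mult summ) auto
    also have "\<dots> = (\<Sum>k. v (Suc k) $ i / s ^ Suc k)"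
    proof (intro suminf_cong)
      fix k
      have "v (Suc k) $ i = (\<Sum>j<n. T $$ (i, j) * v k $ j)"
        using index_mult_mat_vec_sum[OF T_carrier v i, of k] mult_pow_mat_vec[OF T_carrier exit_carrier, of k]
        by (simp only: v_def)
      then show "(\<Sum>j<n. T $$ (i, j) * (v k $ j / s ^ Suc k)) = v (Suc k) $ i / s ^ Suc k"
        by (simp add: sum_divide_distrib)
    qed
    also have "\<dots> = (\<Sum>k. s * (v (Suc k) $ i / s ^ Suc (Suc k)))"
      using s_pos by (intro suminf_cong) simp
    also have "\<dots> = s * (\<Sum>k. v (Suc k) $ i / s ^ Suc (Suc k))"
      by (rule suminf_mult[OF summable_Suc_iff[THEN iffD2, OF summ[OF i]]])
    also have "(\<Sum>k. v (Suc k) $ i / s ^ Suc (Suc k)) = z $ i - v 0 $ i / s"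
      using suminf_split_head[OF summ[OF i]] i by (simp add: z_def)
    also have "v 0 $ i = - (T *\<^sub>v ones n) $ i"
      using i T_carrier exit_carrier by (simp add: v_def exit_def)
    finally show ?thesis
      using s_pos by (simp add: distrib_left)
  qed
  define A where "A = mat_diag n (\<lambda>_. s) + - T"
  have mT: "- T \<in> carrier_mat n n"
    using T_carrier by simp
  have MA: "M_matrix n A"
    unfolding A_def
    by (rule M_matrix_add_diag[OF sub_intensity_imp_M_matrix[OF T]]) (use s_pos in simp)
  have A_mult: "(A *\<^sub>v x) $ i = s * x $ i - (T *\<^sub>v x) $ i" if "i < n" "x \<in> carrier_vec n" for i x
    unfolding A_def index_diag_add_mult_vec[OF mT that(2,1)] using T_carrier that by simp
  have "A *\<^sub>v y = A *\<^sub>v z"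
  proof (rule eq_vecI)
    have dim: "dim_row A = n"
      using MA by (auto simp: M_matrix_def)
    show "dim_vec (A *\<^sub>v y) = dim_vec (A *\<^sub>v z)"
      by simp
    show "(A *\<^sub>v y) $ i = (A *\<^sub>v z) $ i" if "i < dim_vec (A *\<^sub>v z)" for i
      using that dim eq[of i] Tz[of i] A_mult[of i y] A_mult[of i z] y z
      by (simp del: index_mult_mat_vec)
  qed
  then have "y = z"
    by (rule M_matrix_mult_cancel[OF MA y z])
  then have "\<pi> \<bullet> y = (\<Sum>i<n. \<pi> $ i * (\<Sum>k. v k $ i / s ^ Suc k))"
    by (simp add: scalar_prod_def atLeast0LessThan z_def)
  also have "\<dots> = (\<Sum>i<n. \<Sum>k. \<pi> $ i * (v k $ i / s ^ Suc k))"
    by (intro sum.cong refl suminf_mult[symmetric] summ) auto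
  also have "\<dots> = (\<Sum>k. \<Sum>i<n. \<pi> $ i * (v k $ i / s ^ Suc k))"
    by (intro suminf_sum[symmetric] summable_mult summ) auto
  also have "\<dots> = (\<Sum>k. coeff k / s ^ Suc k)"
  proof (intro suminf_cong)
    fix k
    have "coeff k = (\<Sum>i<n. \<pi> $ i * v k $ i)"
      using v[of k] unfolding coeff_def v_def[symmetric] by (simp add: scalar_prod_def atLeast0LessThan)
    then show "(\<Sum>i<n. \<pi> $ i * (v k $ i / s ^ Suc k)) = coeff k / s ^ Suc k"
      by (simp add: sum_divide_distrib)
  qed
  finally show ?thesis .
qed

end

section \<open>The law of a linear combination\<close>

theorem theorem3p8:
  fixes M :: "'a measure" and Y :: "'a \<Rightarrow> real vec"
    and n p :: nat and \<alpha> :: real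
    and \<pi> w \<pi>w :: "real vec" and T R Tw :: "real mat"
    and Ep E0 :: "nat set"
  assumes "prob_space M"
    and "0 < \<alpha>" and "\<alpha> \<le> 1"
    and "nonneg_vec p \<pi>" and "\<pi> \<bullet> ones p = 1"
    and "sub_intensity p T"
    and "nonneg_mat p n R"
    and "mph_distributed M Y n \<alpha> \<pi> T R"
    and "nonneg_vec n w" and "w \<noteq> 0\<^sub>v n"
  defines "Ep \<equiv> {i. i < p \<and> (R *\<^sub>v w) $ i > 0}"
    and "E0 \<equiv> {i. i < p \<and> (R *\<^sub>v w) $ i = 0}"
  defines "\<pi>w \<equiv> subvector \<pi> Ep
                  + subvector \<pi> E0 \<^sub>v* mat_inv (- submatrix T E0 E0) \<^sub>v* submatrix T E0 Ep"
    and "Tw \<equiv> mat_inv (diag_powr (subvector (R *\<^sub>v w) Ep) \<alpha>)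
                  * (submatrix T Ep Ep
                     + submatrix T Ep E0 * mat_inv (- submatrix T E0 E0) * submatrix T E0 Ep)"
  shows "ph_parameters (card Ep) \<pi>w Tw \<and>
         (\<forall>x>0. 0 \<le> ph_density \<alpha> \<pi>w Tw x) \<and>
         (\<forall>A\<in>sets borel.
            emeasure (distr M borel (\<lambda>\<omega>. Y \<omega> \<bullet> w)) A =
              ennreal (1 - \<pi>w \<bullet> ones (card Ep)) * indicator A 0
              + emeasure (ph_measure \<alpha> \<pi>w Tw) A)"
proof -
  interpret prob_space M
    by (rule assms(1))
  define v where "v = R *\<^sub>v w"
  have v_nonneg: "nonneg_vec p v"
    unfolding v_def by (rule nonneg_mat_mult_vec[OF assms(7,9)])
  then have v: "v \<in> carrier_vec p"
    by (simp add: nonneg_vec_def)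
  have w: "w \<in> carrier_vec n" and R: "R \<in> carrier_mat p n" and \<pi>: "\<pi> \<in> carrier_vec p"
    using assms(4,7,9) by (simp_all add: nonneg_vec_def nonneg_mat_def)
  have "Ep \<union> E0 = {..<p}" "Ep \<inter> E0 = {}"
    using v_nonneg unfolding Ep_def E0_def v_def[symmetric] nonneg_vec_def by force+
  then interpret partitioned_sub_intensity p T Ep E0
    using assms(6) by unfold_locales
  have \<pi>w_eq: "\<pi>w = entry_vec \<pi>"
    by (simp add: \<pi>w_def entry_vec_def green_def)
  have Tw_eq: "Tw = mat_inv (diag_powr (subvector v Ep) \<alpha>) * schur"
    by (simp add: Tw_def schur_def green_def v_def)
  have v_Ep: "0 < v $ i" if "i \<in> Ep" for i
    using that by (simp add: Ep_def v_def)
  have v_E0: "v $ i = 0" if "i \<in> E0" for i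
    using that by (simp add: E0_def v_def)
  have Rw: "R *\<^sub>v (u \<cdot>\<^sub>v w) = u \<cdot>\<^sub>v v" for u
    unfolding v_def by (rule mult_mat_vec[OF R w])
  have Tw: "sub_intensity (card Ep) Tw"
    unfolding Tw_eq by (rule mph_laplace_reduction(1)[OF \<pi> v v_Ep v_E0 order.refl Rw])
  have params: "ph_parameters (card Ep) \<pi>w Tw"
    unfolding ph_parameters_def \<pi>w_eq using entry_vec_mass[OF assms(4)] Tw assms(5) by simp
  have \<pi>w: "\<pi>w \<in> carrier_vec (card Ep)"
    unfolding \<pi>w_eq by (rule entry_vec_carrier[OF \<pi>])
  interpret ph: fractional_ph "card Ep" \<alpha> \<pi>w Tw
    using assms(2) \<pi>w Tw by unfold_locales
  define c where "c = 1 - \<pi>w \<bullet> ones (card Ep)"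

  have Y: "\<And>\<omega>. \<omega> \<in> space M \<Longrightarrow> Y \<omega> \<in> carrier_vec n" "\<And>j. j < n \<Longrightarrow> (\<lambda>\<omega>. Y \<omega> $ j) \<in> borel_measurable M"
    "AE \<omega> in M. nonneg_vec n (Y \<omega>)"
    "\<And>\<theta>. nonneg_vec n \<theta> \<Longrightarrow> (\<integral>\<omega>. exp (- (Y \<omega> \<bullet> \<theta>)) \<partial>M) = mph_laplace \<alpha> \<pi> T R \<theta>"
    using assms(8) unfolding mph_distributed_def by blast+
  define Z where "Z \<omega> = Y \<omega> \<bullet> w" for \<omega>
  have Z_meas: "Z \<in> borel_measurable M"
  proof -
    have "(\<lambda>\<omega>. \<Sum>j<n. Y \<omega> $ j * w $ j) \<in> borel_measurable M"
      by (intro borel_measurable_sum borel_measurable_times borel_measurable_const Y(2)) simp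
    moreover have "Z \<omega> = (\<Sum>j<n. Y \<omega> $ j * w $ j)" for \<omega>
      using w by (simp add: Z_def scalar_prod_def atLeast0LessThan)
    ultimately show ?thesis
      by (simp add: Z_def[abs_def])
  qed
  define \<mu> where "\<mu> = distr M borel Z"
  have \<mu>: "finite_measure \<mu>" "sets \<mu> = sets borel"
    unfolding \<mu>_def by (auto intro: finite_measure_distr Z_meas)
  have "AE \<omega> in M. 0 \<le> Z \<omega>"
    using Y(3) by eventually_elim (simp add: Z_def nonneg_scalar_prod[OF _ assms(9)])
  then have \<mu>_nonneg: "AE x in \<mu>. 0 \<le> x"
    unfolding \<mu>_def by (subst AE_distr_iff[OF Z_meas]) auto
  \<comment> \<open>Beyond this point the geometric series for the resolvent converges.\<close>
  define u\<^sub>0 where "u\<^sub>0 = (abs_sum (card Ep) Tw + 1) powr (1 / \<alpha>)"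
  have u\<^sub>0: "0 < u\<^sub>0" "u\<^sub>0 powr \<alpha> = abs_sum (card Ep) Tw + 1"
    using assms(2) abs_sum_nonneg[of "card Ep" Tw] by (auto simp: u\<^sub>0_def powr_powr)
  have large: "0 < u" "abs_sum (card Ep) Tw < u powr \<alpha>" if "u\<^sub>0 \<le> u" for u
    using that u\<^sub>0 powr_mono2[of \<alpha> u\<^sub>0 u] assms(2) by auto
  note series = ph.has_bochner_integral_laplace_ml_series[OF large]
  have transform: "(\<integral>x. exp (- (u * x)) \<partial>\<mu>)
      = c + (\<integral>x. indicator {0<..} x * (ml_series \<alpha> ph.coeff x * exp (- (u * x))) \<partial>lborel)"
    if u: "u\<^sub>0 \<le> u" for u
  proof -
    have u_nonneg: "0 \<le> u"
      using u u\<^sub>0(1) by simp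
    then have uw: "nonneg_vec n (u \<cdot>\<^sub>v w)"
      using assms(9) by (auto simp: nonneg_vec_def)
    obtain y where y: "y \<in> carrier_vec (card Ep)"
      "\<And>i. i < card Ep \<Longrightarrow> (Tw *\<^sub>v y) $ i = u powr \<alpha> * y $ i + (Tw *\<^sub>v ones (card Ep)) $ i"
      "mph_laplace \<alpha> \<pi> T R (u \<cdot>\<^sub>v w) = \<pi> \<bullet> ones p - entry_vec \<pi> \<bullet> ones (card Ep) + entry_vec \<pi> \<bullet> y"
      using mph_laplace_reduction(2)[OF \<pi> v v_Ep v_E0 u_nonneg Rw[of u], of \<alpha>]
      unfolding Tw_eq[symmetric] by blast
    have "(\<integral>x. exp (- (u * x)) \<partial>\<mu>) = (\<integral>\<omega>. exp (- (u * Z \<omega>)) \<partial>M)"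
      unfolding \<mu>_def by (rule integral_distr[OF Z_meas]) simp
    also have "\<dots> = (\<integral>\<omega>. exp (- (Y \<omega> \<bullet> (u \<cdot>\<^sub>v w))) \<partial>M)"
      by (intro Bochner_Integration.integral_cong refl)
        (simp add: Z_def scalar_prod_smult_distrib[OF Y(1) w])
    also have "\<dots> = c + \<pi>w \<bullet> y"
      unfolding Y(4)[OF uw] y(3) by (simp add: c_def \<pi>w_eq assms(5))
    also have "\<pi>w \<bullet> y = (\<Sum>k. ph.coeff k / (u powr \<alpha>) ^ Suc k)"
      by (rule ph.resolvent_eq_series[OF large(2)[OF u] y(1,2)])
    also have "\<dots> = (\<integral>x. indicator {0<..} x * (ml_series \<alpha> ph.coeff x * exp (- (u * x))) \<partial>lborel)"
      by (rule has_bochner_integral_integral_eq[OF series[OF u u], symmetric])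
    finally show ?thesis .
  qed
  have integrable: "integrable lborel (\<lambda>x. indicator {0<..} x * (ml_series \<alpha> ph.coeff x * exp (- (u\<^sub>0 * x))))"
    by (rule integrable.intros[OF series[OF order.refl order.refl]])
  note law = laplace_transform_determines_law[OF \<mu> \<mu>_nonneg less_imp_le[OF u\<^sub>0(1)]
      ph.continuous_on_ml_series integrable transform]
  have "ph_measure \<alpha> \<pi>w Tw = density lborel (\<lambda>x. ennreal (indicator {0<..} x * ml_series \<alpha> ph.coeff x))"
    unfolding ph_measure_def ph.ph_density_eq_ml_series ..
  then show ?thesis
    using params law unfolding \<mu>_def Z_def[abs_def] c_def ph.ph_density_eq_ml_series by auto
qed

end
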